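(* Let $\Omega\subset\mathbb{H}$ be a circular domain and $f,g\in\mathcal{SEM}(\Omega)$. The Sylvester operator $\mathcal{S}_{f,g}:\mathcal{SEM}(\Omega)\to\mathcal{SEM}(\Omega)$, $\mathcal{S}_{f,g}(\chi)=f*\chi+\chi*g$, is not an isomorphism if and only if one of the two following conditions holds: (1) $f\simeq -g$; (2) there exists a zero divisor $\chi\in\mathcal{SEM}(\Omega)$ such that $(f,-g)$ intertwines with $\chi$, i.e. $f*\chi=\chi*(-g)$.
   Context: $\mathbb{H}$ denotes the quaternions, $q^c$ the quaternionic conjugate, $\mathbb{S}=\{q\in\mathbb{H}: q^2=-1\}$, and $\mathbb{C}_I=\mathbb{R}+I\mathbb{R}$ for $I\in\mathbb{S}$. For $q=x+Iy$ put $\mathbb{S}_q=\{x+Jy: J\in\mathbb{S}\}$. A domain (connected open set) $\Omega\subset\mathbb{H}$ is circular if $\mathbb{S}_q\subset\Omega$ for all $q\in\Omega$. A function $f$ on a circular open set $\Omega$ is slice regular ($f\in\mathcal{SR}(\Omega)$) if $f(x+Iy)=F_1(x,y)+IF_2(x,y)$ for all $x+Iy\in\Omega$ ($x,y\in\mathbb{R}$, $I\in\mathbb{S}$), with $\mathbb{H}$-valued $F_1$ even in $y$ and $F_2$ odd in $y$, and each restriction $f|_{\Omega\cap\mathbb{C}_I}$ is real differentiable with $\frac12(\partial_x+I\partial_y)f|_{\Omega\cap\mathbb{C}_I}\equiv0$. The $*$-product is $(f*g)(q)=0$ if $f(q)=0$ and $(f*g)(q)=f(q)\,g(f(q)^{-1}qf(q))$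 otherwise. $f$ is slice preserving if $f(\Omega\cap\mathbb{C}_I)\subset\mathbb{C}_I$ for every $I\in\mathbb{S}$. A function $f$ is slice semi-regular on $\Omega$ ($f\in\mathcal{SEM}(\Omega)$) if there is a circular open $\widetilde\Omega\subseteq\Omega$ with $f\in\mathcal{SR}(\widetilde\Omega)$ and each point of $\Omega\setminus\widetilde\Omega$ is a pole or a removable singularity; i.e. $\Omega\setminus\widetilde\Omega$ consists of isolated real points and isolated spheres $\mathbb{S}_p$, near each of which $\Delta_p^m f$ extends slice regularly for some integer $m\ge0$, where $\Delta_p(q)=q^2-2\mathrm{Re}(p)q+|p|^2$. Functions agreeing where both are defined are identified. $\mathcal{SEM}_{\mathbb{R}}(\Omega)$ is the subset of slice preserving elements; it is a field and the center of the algebra $(\mathcal{SEM}(\Omega),+,* )$, which is a 4-dimensional vector space over it: for an orthonormal basis $(1,I,J,K)$ of $\mathbb{H}$, each $f$ is uniquely $f_0+f_1I+f_2J+f_3K$ with $f_\ell\in\mathcal{SEM}_{\mathbb{R}}(\Omega)$. Set $f^c=f_0-(f_1I+f_2J+f_3K)$, $f^s=f*f^c=f_0^2+f_1^2+f_2^2+f_3^2$. $f$ is $*$-invertible iff $f^s\not\equiv0$, with $f^{-*}=(f^s)^{-1}f^c$. A zero divisor is $f\not\equiv0$ with $f^s\equiv0$ (equivalently $f\not\equiv 0$ and $f*g\equiv0$ for some $g\not\equiv0$). We write $f\simeq g$ if there is a $*$-invertible $h\in\mathcal{SEM}(\Omega)$ with $f=h^{-*}*g*h$. Isomorphism means isomorphism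 of $\mathcal{SEM}_{\mathbb{R}}(\Omega)$-vector spaces. *)

theory Defs
  imports "HOL-Analysis.Analysis" "HOL-Algebra.Module"
begin

section \<open>Quaternions\<close>

datatype quat = Quat (Req: real) (Im1: real) (Im2: real) (Im3: real)

lemma quat_eq_iff:
  "p = q \<longleftrightarrow> Req p = Req q \<and> Im1 p = Im1 q \<and> Im2 p = Im2 q \<and> Im3 p = Im3 q"
  by (auto intro: quat.expand)

instantiation quat :: ring_1
begin

definition "0 = Quat 0 0 0 0"
definition "1 = Quat 1 0 0 0"
definition "- p = Quat (- Req p) (- Im1 p) (- Im2 p) (- Im3 p)"
definition "p + q = Quat (Req p + Req q) (Im1 p + Im1 q) (Im2 p + Im2 q) (Im3 p + Im3 q)"
definition "p - q = Quat (Req p - Req q) (Im1 p - Im1 q) (Im2 p - Im2 q) (Im3 p - Im3 q)"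
definition "p * q = Quat
  (Req p * Req q - Im1 p * Im1 q - Im2 p * Im2 q - Im3 p * Im3 q)
  (Req p * Im1 q + Im1 p * Req q + Im2 p * Im3 q - Im3 p * Im2 q)
  (Req p * Im2 q - Im1 p * Im3 q + Im2 p * Req q + Im3 p * Im1 q)
  (Req p * Im3 q + Im1 p * Im2 q - Im2 p * Im1 q + Im3 p * Req q)"

lemmas quat_ring_defs =
  zero_quat_def one_quat_def uminus_quat_def plus_quat_def minus_quat_def times_quat_def

instance
  by standard (simp_all add: quat_eq_iff quat_ring_defs algebra_simps)

end

instantiation quat :: real_inner
begin

definition "scaleR r q = Quat (r * Req q) (r * Im1 q) (r * Im2 q) (r * Im3 q)" for q :: quat
definition "inner p q = Req p * Req q + Im1 p * Im1 q + Im2 p * Im2 q + Im3 p * Im3 q" for p q :: quat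
definition "norm q = sqrt (inner q q)" for q :: quat
definition "sgn q = scaleR (inverse (norm q)) q" for q :: quat
definition "dist p q = norm (p - q)" for p q :: quat
definition "uniformity = (INF e\<in>{0 <..}. principal {(p :: quat, q). dist p q < e})"
definition "open U = (\<forall>p\<in>U. eventually (\<lambda>(p', q). p' = p \<longrightarrow> q \<in> U) uniformity)" for U :: "quat set"

instance
proof
  fix p q r :: quat and a b :: real
  show "inner p p = 0 \<longleftrightarrow> p = 0"
    by (auto simp: inner_quat_def quat_eq_iff zero_quat_def add_nonneg_eq_0_iff)
  show "uniformity = (INF e\<in>{0 <..}. principal {(p :: quat, q). dist p q < e})"
    by (rule uniformity_quat_def)
  show "open U = (\<forall>p\<in>U. eventually (\<lambda>(p', q). p' = p \<longrightarrow> q \<in> U) uniformity)" for U :: "quat set"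
    by (rule open_quat_def)
qed (simp_all add: quat_eq_iff quat_ring_defs scaleR_quat_def inner_quat_def norm_quat_def
      sgn_quat_def dist_quat_def algebra_simps)

end

instance quat :: real_algebra_1
  by standard (simp_all add: quat_eq_iff quat_ring_defs scaleR_quat_def algebra_simps)

instantiation quat :: real_normed_div_algebra
begin

definition "inverse q = scaleR (inverse (inner q q)) (Quat (Req q) (- Im1 q) (- Im2 q) (- Im3 q))" for q :: quat
definition "divide p q = p * inverse q" for p q :: quat

instance
proof
  fix p q :: quat
  let ?c = "Quat (Req p) (- Im1 p) (- Im2 p) (- Im3 p)"
  have "?c * p = scaleR (inner p p) 1" "p * ?c = scaleR (inner p p) 1"
    by (simp_all add: quat_eq_iff times_quat_def one_quat_def scaleR_quat_def inner_quat_def)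
  then show "inverse p * p = 1" "p * inverse p = 1" if "p \<noteq> 0"
    using that by (simp_all add: inverse_quat_def)
  show "norm (p * q) = norm p * norm q"
    unfolding norm_quat_def real_sqrt_mult[symmetric]
    by (rule arg_cong[where f = sqrt]) (simp add: inner_quat_def times_quat_def algebra_simps)
  show "inverse (0 :: quat) = 0"
    by (simp add: inverse_quat_def)
qed (rule divide_quat_def)

end

definition quat_i :: quat where "quat_i = Quat 0 1 0 0"
definition quat_j :: quat where "quat_j = Quat 0 0 1 0"
definition quat_k :: quat where "quat_k = Quat 0 0 0 1"

definition imag_units :: "quat set" where
  "imag_units = {q. q ^ 2 = - 1}"

definition slice_plane :: "quat \<Rightarrow> quat set" where
  "slice_plane I = {of_real x + I * of_real y | x y. True}"

text \<open>The sphere \<open>\<bbbS>\<^sub>q\<close>; it is \<open>{q}\<close> for real \<open>q\<close>.\<close>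

definition sphere_of :: "quat \<Rightarrow> quat set" where
  "sphere_of q = {of_real x + J * of_real y | x y I J.
     I \<in> imag_units \<and> J \<in> imag_units \<and> q = of_real x + I * of_real y}"

definition circular :: "quat set \<Rightarrow> bool" where
  "circular \<Omega> \<longleftrightarrow> (\<forall>q\<in>\<Omega>. sphere_of q \<subseteq> \<Omega>)"


section \<open>Slice regular functions\<close>

definition slice_regular_on :: "quat set \<Rightarrow> (quat \<Rightarrow> quat) \<Rightarrow> bool" where
  "slice_regular_on \<Omega> f \<longleftrightarrow>
     (\<exists>F1 F2 :: real \<Rightarrow> real \<Rightarrow> quat. \<forall>I\<in>imag_units. \<forall>x y. of_real x + I * of_real y \<in> \<Omega> \<longrightarrow>
        f (of_real x + I * of_real y) = F1 x y + I * F2 x y \<and>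
        F1 x (- y) = F1 x y \<and> F2 x (- y) = - F2 x y) \<and>
     (\<forall>I\<in>imag_units. \<forall>x y. of_real x + I * of_real y \<in> \<Omega> \<longrightarrow>
        (\<exists>D. ((\<lambda>(u, v). f (of_real u + I * of_real v)) has_derivative D) (at (x, y)) \<and>
             (1 / 2) *\<^sub>R (D (1, 0) + I * D (0, 1)) = 0))"

definition star :: "(quat \<Rightarrow> quat) \<Rightarrow> (quat \<Rightarrow> quat) \<Rightarrow> quat \<Rightarrow> quat" where
  "star f g q = (if f q = 0 then 0 else f q * g (inverse (f q) * q * f q))"

definition slice_preserving_on :: "quat set \<Rightarrow> (quat \<Rightarrow> quat) \<Rightarrow> bool" where
  "slice_preserving_on \<Omega> f \<longleftrightarrow> (\<forall>I\<in>imag_units. f ` (\<Omega> \<inter> slice_plane I) \<subseteq> slice_plane I)"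


section \<open>Slice semi-regular functions\<close>

definition Delta :: "quat \<Rightarrow> quat \<Rightarrow> quat" where
  "Delta p q = q ^ 2 - of_real (2 * Req p) * q + of_real ((norm p) ^ 2)"

text \<open>
  A semi-regular function is represented by a total function together with the existence of a set
  \<open>D\<close> on which it is slice regular; its values outside \<open>D\<close> carry no meaning. The
  neighbourhood \<open>V\<close> says both that the sphere of \<open>p\<close> is isolated in the exceptional set
  and that the singularity is a pole or removable.
\<close>

definition sem_domain :: "quat set \<Rightarrow> (quat \<Rightarrow> quat) \<Rightarrow> quat set \<Rightarrow> bool" where
  "sem_domain \<Omega> f D \<longleftrightarrow>
     D \<subseteq> \<Omega> \<and> open D \<and> circular D \<and> slice_regular_on D f \<and>
     (\<forall>p\<in>\<Omega> - D. \<exists>V g m. p \<in> V \<and> V \<subseteq> \<Omega> \<and> open V \<and> circular V \<and> V - sphere_of p \<subseteq> D \<and>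
        slice_regular_on V g \<and> (\<forall>q\<in>V - sphere_of p. g q = Delta p q ^ m * f q))"

definition sem_rel :: "quat set \<Rightarrow> ((quat \<Rightarrow> quat) \<times> (quat \<Rightarrow> quat)) set" where
  "sem_rel \<Omega> = {(f, g). \<exists>D E. sem_domain \<Omega> f D \<and> sem_domain \<Omega> g E \<and> (\<forall>q\<in>D \<inter> E. f q = g q)}"

type_synonym sem = "(quat \<Rightarrow> quat) set"

definition sem_class :: "quat set \<Rightarrow> (quat \<Rightarrow> quat) \<Rightarrow> sem" where
  "sem_class \<Omega> f = sem_rel \<Omega> `` {f}"

definition sem_lift2 ::
  "quat set \<Rightarrow> ((quat \<Rightarrow> quat) \<Rightarrow> (quat \<Rightarrow> quat) \<Rightarrow> quat \<Rightarrow> quat) \<Rightarrow> sem \<Rightarrow> sem \<Rightarrow> sem" where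
  "sem_lift2 \<Omega> h A B = (\<Union>f\<in>A. \<Union>g\<in>B. sem_class \<Omega> (h f g))"

definition SEM :: "quat set \<Rightarrow> (sem, sem) module" where
  "SEM \<Omega> = \<lparr>carrier = {f. \<exists>D. sem_domain \<Omega> f D} // sem_rel \<Omega>,
     mult = sem_lift2 \<Omega> star,
     one = sem_class \<Omega> (\<lambda>_. 1),
     zero = sem_class \<Omega> (\<lambda>_. 0),
     add = sem_lift2 \<Omega> (\<lambda>f g q. f q + g q),
     smult = sem_lift2 \<Omega> star\<rparr>"

definition SEM_R :: "quat set \<Rightarrow> (sem, sem) module" where
  "SEM_R \<Omega> = (SEM \<Omega>)\<lparr>carrier :=
     {A \<in> carrier (SEM \<Omega>). \<exists>f\<in>A. \<exists>D. sem_domain \<Omega> f D \<and> slice_preserving_on D f}\<rparr>"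

text \<open>\<open>f\<^sup>c\<close>, from the decomposition of \<open>f\<close> with respect to the orthonormal basis
  \<open>(1, i, j, k)\<close>; another orthonormal basis \<open>(1, I, J, K)\<close> yields the same \<open>f\<^sup>c\<close>.\<close>

definition sem_conj :: "quat set \<Rightarrow> sem \<Rightarrow> sem" where
  "sem_conj \<Omega> f = (THE c. \<exists>f0\<in>carrier (SEM_R \<Omega>). \<exists>f1\<in>carrier (SEM_R \<Omega>).
     \<exists>f2\<in>carrier (SEM_R \<Omega>). \<exists>f3\<in>carrier (SEM_R \<Omega>).
       (let v = f1 \<otimes>\<^bsub>SEM \<Omega>\<^esub> sem_class \<Omega> (\<lambda>_. quat_i)
                \<oplus>\<^bsub>SEM \<Omega>\<^esub> f2 \<otimes>\<^bsub>SEM \<Omega>\<^esub> sem_class \<Omega> (\<lambda>_. quat_j)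
                \<oplus>\<^bsub>SEM \<Omega>\<^esub> f3 \<otimes>\<^bsub>SEM \<Omega>\<^esub> sem_class \<Omega> (\<lambda>_. quat_k)
        in f = f0 \<oplus>\<^bsub>SEM \<Omega>\<^esub> v \<and> c = f0 \<ominus>\<^bsub>SEM \<Omega>\<^esub> v))"

definition sem_symm :: "quat set \<Rightarrow> sem \<Rightarrow> sem" where
  "sem_symm \<Omega> f = f \<otimes>\<^bsub>SEM \<Omega>\<^esub> sem_conj \<Omega> f"

definition star_invertible :: "quat set \<Rightarrow> sem \<Rightarrow> bool" where
  "star_invertible \<Omega> f \<longleftrightarrow> f \<in> carrier (SEM \<Omega>) \<and> sem_symm \<Omega> f \<noteq> \<zero>\<^bsub>SEM \<Omega>\<^esub>"

definition star_inverse :: "quat set \<Rightarrow> sem \<Rightarrow> sem" where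
  "star_inverse \<Omega> f = inv\<^bsub>SEM_R \<Omega>\<^esub> (sem_symm \<Omega> f) \<otimes>\<^bsub>SEM \<Omega>\<^esub> sem_conj \<Omega> f"

definition sem_zero_divisor :: "quat set \<Rightarrow> sem \<Rightarrow> bool" where
  "sem_zero_divisor \<Omega> f \<longleftrightarrow>
     f \<in> carrier (SEM \<Omega>) \<and> f \<noteq> \<zero>\<^bsub>SEM \<Omega>\<^esub> \<and> sem_symm \<Omega> f = \<zero>\<^bsub>SEM \<Omega>\<^esub>"

definition star_conjugate :: "quat set \<Rightarrow> sem \<Rightarrow> sem \<Rightarrow> bool" where
  "star_conjugate \<Omega> f g \<longleftrightarrow>
     (\<exists>h. star_invertible \<Omega> h \<and> f = star_inverse \<Omega> h \<otimes>\<^bsub>SEM \<Omega>\<^esub> g \<otimes>\<^bsub>SEM \<Omega>\<^esub> h)"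

definition intertwines :: "quat set \<Rightarrow> sem \<Rightarrow> sem \<Rightarrow> sem \<Rightarrow> bool" where
  "intertwines \<Omega> f g X \<longleftrightarrow> f \<otimes>\<^bsub>SEM \<Omega>\<^esub> X = X \<otimes>\<^bsub>SEM \<Omega>\<^esub> g"

definition sylvester :: "quat set \<Rightarrow> sem \<Rightarrow> sem \<Rightarrow> sem \<Rightarrow> sem" where
  "sylvester \<Omega> f g X = f \<otimes>\<^bsub>SEM \<Omega>\<^esub> X \<oplus>\<^bsub>SEM \<Omega>\<^esub> X \<otimes>\<^bsub>SEM \<Omega>\<^esub> g"

definition module_iso ::
  "('a, 'k) ring_scheme \<Rightarrow> ('a, 'b, 'm) module_scheme \<Rightarrow> ('a, 'c, 'n) module_scheme \<Rightarrow> ('b \<Rightarrow> 'c) set" where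
  "module_iso R M N = {T. bij_betw T (carrier M) (carrier N) \<and>
     (\<forall>x\<in>carrier M. \<forall>y\<in>carrier M. T (x \<oplus>\<^bsub>M\<^esub> y) = T x \<oplus>\<^bsub>N\<^esub> T y) \<and>
     (\<forall>a\<in>carrier R. \<forall>x\<in>carrier M. T (a \<odot>\<^bsub>M\<^esub> x) = a \<odot>\<^bsub>N\<^esub> T x)}"

end

theory Submission
  imports Defs "HOL-Complex_Analysis.Complex_Analysis"
begin

text \<open>
  The class of a semi-regular function \<open>f\<close> is determined by four ordinary meromorphic functions of one
  complex variable. Writing \<open>f (x + J y) = F\<^sub>1 (x, y) + J F\<^sub>2 (x, y)\<close>, the stem function
  \<open>F\<^sub>1 + \<i> F\<^sub>2\<close> takes values in the quaternions with complex coefficients. Regularity of \<open>f\<close>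
  means holomorphy of its components, semi-regularity means that they are meromorphic
  (\<open>sem_domain_iff\<close>), they satisfy \<open>h (cnj z) = cnj (h z)\<close>, the star product becomes the pointwise
  product (\<open>star_slice_eval\<close>), and slice preserving functions are those with only a scalar component.

  Fix a point \<open>z\<^sub>0\<close> of the complex domain over which \<open>\<Omega>\<close> lies and expand the four
  components in Laurent series there. By the identity theorem (\<open>meromorphic_identity\<close>) two semi-regular functions are identified exactly when
  these expansions agree (\<open>sem_rel_iff\<close>). So the semi-regular classes form the
  quaternions over a subfield \<open>K\<close> of the field of complex Laurent series, where \<open>K\<close> itself corresponds to the
  slice preserving classes. The subfield structure of \<open>K\<close> replaces all
  division in the algebra of classes: conjugate, symmetrization and inverse are computed in coordinates.

  What remains is algebra in the quaternions over a field \<open>K\<close> of characteristic zero. The operator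
  \<open>S x = a x + x b\<close> is bijective iff it is injective (\<open>sylvester_bij_iff\<close>). A nonzero \<open>u\<close> in
  its kernel satisfies \<open>a u = u (- b)\<close>. If the norm of \<open>u\<close> is nonzero, \<open>u\<close> is invertible and
  conjugates \<open>- b\<close> into \<open>a\<close>, which is the first condition; if the norm vanishes,
  \<open>u\<close> is a zero divisor, which is the second. Conversely the conjugate of a conjugating element is
  an invertible intertwiner (\<open>conjugate_iff_invertible_intertwiner\<close>), hence a nonzero element of the kernel.
\<close>

section \<open>Quaternion algebras over a field\<close>

text \<open>
  The coefficients are kept general because two instances occur: complex coefficients for the
  values of stem functions, and coefficients in the field of Laurent series for classes of
  semi-regular functions.
\<close>

datatype 'a qtn = Qtn (comp0: 'a) (comp1: 'a) (comp2: 'a) (comp3: 'a)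

lemma qtn_eq_iff:
  "x = y \<longleftrightarrow> comp0 x = comp0 y \<and> comp1 x = comp1 y \<and> comp2 x = comp2 y \<and> comp3 x = comp3 y"
  by (auto intro: qtn.expand)

instantiation qtn :: (comm_ring_1) ring_1
begin

definition "0 = Qtn 0 0 0 0"
definition "1 = Qtn 1 0 0 0"
definition "- x = Qtn (- comp0 x) (- comp1 x) (- comp2 x) (- comp3 x)"
definition "x + y =
  Qtn (comp0 x + comp0 y) (comp1 x + comp1 y) (comp2 x + comp2 y) (comp3 x + comp3 y)"
definition "x - y =
  Qtn (comp0 x - comp0 y) (comp1 x - comp1 y) (comp2 x - comp2 y) (comp3 x - comp3 y)"
definition "x * y = Qtn
  (comp0 x * comp0 y - comp1 x * comp1 y - comp2 x * comp2 y - comp3 x * comp3 y)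
  (comp0 x * comp1 y + comp1 x * comp0 y + comp2 x * comp3 y - comp3 x * comp2 y)
  (comp0 x * comp2 y - comp1 x * comp3 y + comp2 x * comp0 y + comp3 x * comp1 y)
  (comp0 x * comp3 y + comp1 x * comp2 y - comp2 x * comp1 y + comp3 x * comp0 y)"

lemmas qtn_ring_defs =
  zero_qtn_def one_qtn_def uminus_qtn_def plus_qtn_def minus_qtn_def times_qtn_def

instance
  by standard (simp_all add: qtn_eq_iff qtn_ring_defs algebra_simps)

end

definition qtn_conj :: "'a::comm_ring_1 qtn \<Rightarrow> 'a qtn" where
  "qtn_conj x = Qtn (comp0 x) (- comp1 x) (- comp2 x) (- comp3 x)"

definition qtn_norm :: "'a::comm_ring_1 qtn \<Rightarrow> 'a" where
  "qtn_norm x = comp0 x ^ 2 + comp1 x ^ 2 + comp2 x ^ 2 + comp3 x ^ 2"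

definition qtn_of :: "'a::comm_ring_1 \<Rightarrow> 'a qtn" where
  "qtn_of a = Qtn a 0 0 0"

lemmas qtn_simps = qtn_eq_iff qtn_ring_defs qtn_conj_def qtn_norm_def qtn_of_def

lemma qtn_of_central: "qtn_of a * x = x * qtn_of a"
  by (simp add: qtn_simps mult.commute)

lemma qtn_of_mult: "qtn_of (a * b) = qtn_of a * qtn_of b"
  by (simp add: qtn_simps)

lemma qtn_of_eq_0_iff: "qtn_of a = 0 \<longleftrightarrow> a = 0"
  by (simp add: qtn_simps)

lemma qtn_of_1: "qtn_of 1 = 1"
  by (simp add: qtn_simps)

lemma qtn_mult_conj: "x * qtn_conj x = qtn_of (qtn_norm x)"
  by (simp add: qtn_simps algebra_simps power2_eq_square)

lemma qtn_conj_mult: "qtn_conj x * x = qtn_of (qtn_norm x)"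
  by (simp add: qtn_simps algebra_simps power2_eq_square)

lemma qtn_conj_conj: "qtn_conj (qtn_conj x) = x"
  by (simp add: qtn_simps)

lemma qtn_norm_conj: "qtn_norm (qtn_conj x) = qtn_norm x"
  by (simp add: qtn_simps)

lemma qtn_conj_eq_0_iff: "qtn_conj x = 0 \<longleftrightarrow> x = 0"
  by (simp add: qtn_simps)

lemma qtn_trace: "qtn_conj x + x = qtn_of (2 * comp0 x)"
  by (simp add: qtn_simps)

abbreviation qtn_i :: "'a::comm_ring_1 qtn" where "qtn_i \<equiv> Qtn 0 1 0 0"
abbreviation qtn_j :: "'a::comm_ring_1 qtn" where "qtn_j \<equiv> Qtn 0 0 1 0"
abbreviation qtn_k :: "'a::comm_ring_1 qtn" where "qtn_k \<equiv> Qtn 0 0 0 1"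

text \<open>
  A quaternion algebra is simple, so the two-sided ideal generated by a nonzero \<open>X\<close> cannot
  annihilate a nonzero \<open>u\<close>. Concretely, averaging \<open>X\<close> over the quaternion group gives
  \<open>X - i X i - j X j - k X k = 4 x\<^sub>0\<close>, where \<open>x\<^sub>0\<close> is the scalar part of \<open>X\<close>.
\<close>

lemma annihilator_scalar_part:
  fixes X u :: "'a::field_char_0 qtn"
  assumes "u \<noteq> 0" and "\<And>c. c \<in> {1, qtn_i, qtn_j, qtn_k} \<Longrightarrow> X * c * u = 0"
  shows "comp0 X = 0"
proof -
  have "qtn_of (4 * comp0 X) = X * 1 - qtn_i * (X * qtn_i) - qtn_j * (X * qtn_j) - qtn_k * (X * qtn_k)"
    by (simp add: qtn_simps)
  then have "qtn_of (4 * comp0 X) * u =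
      X * 1 * u - qtn_i * (X * qtn_i * u) - qtn_j * (X * qtn_j * u) - qtn_k * (X * qtn_k * u)"
    by (simp only: left_diff_distrib mult.assoc)
  also have "\<dots> = 0"
    by (simp only: assms(2) insert_iff simp_thms mult_zero_right diff_zero)
  finally have "qtn_of (4 * comp0 X) * u = 0" .
  with \<open>u \<noteq> 0\<close> show ?thesis
    by (auto simp: qtn_simps)
qed

lemma annihilator_of_nonzero:
  fixes X u :: "'a::field_char_0 qtn"
  assumes "u \<noteq> 0" and "\<And>c. c \<in> {1, qtn_i, qtn_j, qtn_k} \<Longrightarrow> X * c * u = 0"
  shows "X = 0"
proof -
  have *: "comp0 (e * X) = 0" for e
    by (rule annihilator_scalar_part[OF assms(1)]) (simp add: mult.assoc assms(2)[unfolded mult.assoc])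
  show ?thesis
    using *[of 1] *[of qtn_i] *[of qtn_j] *[of qtn_k]
    by (simp add: qtn_simps)
qed

locale coefficient_field =
  fixes K :: "'a::field_char_0 set"
  assumes one_mem: "1 \<in> K"
    and minus_mem: "a \<in> K \<Longrightarrow> - a \<in> K"
    and add_mem: "a \<in> K \<Longrightarrow> b \<in> K \<Longrightarrow> a + b \<in> K"
    and mult_mem: "a \<in> K \<Longrightarrow> b \<in> K \<Longrightarrow> a * b \<in> K"
    and inverse_mem: "a \<in> K \<Longrightarrow> inverse a \<in> K"
begin

definition quaternions :: "'a qtn set" where
  "quaternions = {x. set_qtn x \<subseteq> K}"

lemma zero_mem: "0 \<in> K"
  using add_mem[OF one_mem minus_mem[OF one_mem]] by simp

lemma diff_mem: "a \<in> K \<Longrightarrow> b \<in> K \<Longrightarrow> a - b \<in> K"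
  using add_mem[of a "- b"] minus_mem[of b] by simp

lemma power2_mem: "a \<in> K \<Longrightarrow> a ^ 2 \<in> K"
  by (simp add: power2_eq_square mult_mem)

lemmas K_closed = zero_mem one_mem minus_mem add_mem diff_mem mult_mem inverse_mem power2_mem

lemma Qtn_mem_iff: "Qtn a b c d \<in> quaternions \<longleftrightarrow> a \<in> K \<and> b \<in> K \<and> c \<in> K \<and> d \<in> K"
  by (auto simp: quaternions_def)

lemma mem_quaternions_iff:
  "x \<in> quaternions \<longleftrightarrow> comp0 x \<in> K \<and> comp1 x \<in> K \<and> comp2 x \<in> K \<and> comp3 x \<in> K"
  by (cases x) (simp add: Qtn_mem_iff)

lemma quaternions_closed:
  "0 \<in> quaternions" "1 \<in> quaternions"
  "x \<in> quaternions \<Longrightarrow> - x \<in> quaternions"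
  "x \<in> quaternions \<Longrightarrow> y \<in> quaternions \<Longrightarrow> x + y \<in> quaternions"
  "x \<in> quaternions \<Longrightarrow> y \<in> quaternions \<Longrightarrow> x * y \<in> quaternions"
  "x \<in> quaternions \<Longrightarrow> qtn_conj x \<in> quaternions"
  "a \<in> K \<Longrightarrow> qtn_of a \<in> quaternions"
  "x \<in> quaternions \<Longrightarrow> y \<in> quaternions \<Longrightarrow> x - y \<in> quaternions"
  by (simp_all add: mem_quaternions_iff qtn_ring_defs qtn_conj_def qtn_of_def K_closed)

lemma qtn_norm_mem: "x \<in> quaternions \<Longrightarrow> qtn_norm x \<in> K"
  by (simp add: mem_quaternions_iff qtn_norm_def K_closed)

text \<open>
  Surjectivity comes from an explicit quasi-inverse. With \<open>S x = a x + x b\<close> and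
  \<open>S' x = a\<^sup>c x + x b\<close>, both \<open>S S'\<close> and \<open>S' S\<close> are right multiplication by
  \<open>w = a a\<^sup>c + (a + a\<^sup>c) b + b\<^sup>2\<close>, because \<open>a a\<^sup>c\<close> and \<open>a + a\<^sup>c\<close> are
  scalars. If \<open>w\<close> is invertible, so is \<open>S\<close>. Otherwise some \<open>u \<noteq> 0\<close> has
  \<open>u w = 0\<close>; were \<open>S\<close> injective, \<open>S'\<close> would kill the left ideal generated by
  \<open>u\<close>, which forces \<open>a\<close> to be a scalar, hence \<open>S = S'\<close> and \<open>S u = 0\<close>.
\<close>

lemma sylvester_bij_if_no_kernel:
  assumes a: "a \<in> quaternions" and b: "b \<in> quaternions"
    and no_kernel: "\<And>u. u \<in> quaternions \<Longrightarrow> a * u + u * b = 0 \<Longrightarrow> u = 0"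
  shows "bij_betw (\<lambda>x. a * x + x * b) quaternions quaternions"
proof -
  define S where "S x = a * x + x * b" for x
  define S' where "S' x = qtn_conj a * x + x * b" for x
  define w where "w = qtn_of (qtn_norm a) + qtn_of (2 * comp0 a) * b + b * b"
  have w_mem: "w \<in> quaternions"
  proof -
    have "2 * comp0 a \<in> K"
      using a by (subst mult_2) (simp only: mem_quaternions_iff add_mem)
    then show ?thesis
      using a b unfolding w_def by (intro quaternions_closed qtn_norm_mem)
  qed
  have closed: "S x \<in> quaternions" "S' x \<in> quaternions" if "x \<in> quaternions" for x
    using that a b by (simp_all add: S_def S'_def quaternions_closed)
  have SS': "S (S' x) = x * w" for x
  proof -
    have "S (S' x) = (a * qtn_conj a) * x + (qtn_conj a + a) * x * b + x * b * b"
      by (simp add: S_def S'_def algebra_simps)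
    also have "\<dots> = x * w"
      unfolding qtn_mult_conj qtn_trace qtn_of_central[of _ x]
      by (simp add: w_def distrib_left mult.assoc)
    finally show ?thesis .
  qed
  show ?thesis
  proof (cases "qtn_norm w = 0")
    case False
    define w' where "w' = qtn_of (inverse (qtn_norm w)) * qtn_conj w"
    have "w' * w = qtn_of (inverse (qtn_norm w) * qtn_norm w)"
      by (simp add: w'_def mult.assoc qtn_conj_mult qtn_of_mult)
    then have w'w: "w' * w = 1"
      using False by (simp add: qtn_of_1)
    have w'_mem: "w' \<in> quaternions"
      by (simp add: w'_def quaternions_closed w_mem K_closed qtn_norm_mem)
    have "inj_on S quaternions"
    proof (rule inj_onI)
      fix x y assume xy: "x \<in> quaternions" "y \<in> quaternions" "S x = S y"
      then have "a * (x - y) + (x - y) * b = 0"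
        by (simp add: S_def algebra_simps)
      moreover have "x - y \<in> quaternions"
        using xy by (simp add: quaternions_closed)
      ultimately show "x = y"
        using no_kernel by fastforce
    qed
    moreover have "y \<in> S ` quaternions" if y: "y \<in> quaternions" for y
    proof
      show "y = S (S' (y * w'))"
        by (simp add: SS' mult.assoc w'w)
      show "S' (y * w') \<in> quaternions"
        using closed y w'_mem by (simp add: quaternions_closed)
    qed
    ultimately have "bij_betw S quaternions quaternions"
      using closed unfolding bij_betw_def by blast
    then show ?thesis
      by (simp add: S_def[abs_def])
  next
    case True
    define u where "u = (if w = 0 then 1 else qtn_conj w)"
    have u: "u \<in> quaternions" "u \<noteq> 0" "u * w = 0"
      using True by (auto simp: u_def quaternions_closed w_mem qtn_conj_mult qtn_of_eq_0_iff
          qtn_conj_eq_0_iff)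
    have kill: "qtn_conj a * (c * u) = - (c * u * b)" if "c \<in> quaternions" for c
    proof -
      have "S (S' (c * u)) = 0"
        by (simp add: SS' mult.assoc u)
      moreover have "S' (c * u) \<in> quaternions"
        using that u by (simp add: closed quaternions_closed)
      ultimately have "S' (c * u) = 0"
        using no_kernel by (auto simp: S_def)
      then show ?thesis
        by (simp add: S'_def eq_neg_iff_add_eq_0)
    qed
    have commutes: "qtn_conj a * e = e * qtn_conj a" if e: "e \<in> quaternions" for e
    proof -
      have "(qtn_conj a * e - e * qtn_conj a) * c * u = 0" if "c \<in> quaternions" for c
      proof -
        have "(qtn_conj a * e - e * qtn_conj a) * c * u =
            qtn_conj a * (e * c * u) - e * (qtn_conj a * (c * u))"
          by (simp only: left_diff_distrib mult.assoc)
        also have "\<dots> = - (e * c * u * b) - e * - (c * u * b)"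
          by (simp only: kill[OF quaternions_closed(5)[OF e that]] kill[OF that])
        also have "\<dots> = 0"
          by (simp only: mult.assoc mult_minus_right diff_minus_eq_add left_minus)
        finally show ?thesis .
      qed
      then have "qtn_conj a * e - e * qtn_conj a = 0"
        by (rule annihilator_of_nonzero[OF u(2)]) (auto simp: Qtn_mem_iff K_closed quaternions_closed)
      then show ?thesis
        by simp
    qed
    have "qtn_conj a = a"
      using commutes[of qtn_i] commutes[of qtn_j]
      by (simp add: Qtn_mem_iff K_closed qtn_simps)
    then have "a * u + u * b = 0"
      using kill[OF quaternions_closed(2)] by simp
    with no_kernel u show ?thesis
      by blast
  qed
qed

lemma sylvester_bij_iff:
  assumes a: "a \<in> quaternions" and b: "b \<in> quaternions"
  shows "bij_betw (\<lambda>x. a * x + x * b) quaternions quaternions \<longleftrightarrow>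
    (\<forall>u\<in>quaternions. a * u = u * - b \<longrightarrow> u = 0)"
proof
  assume bij: "bij_betw (\<lambda>x. a * x + x * b) quaternions quaternions"
  show "\<forall>u\<in>quaternions. a * u = u * - b \<longrightarrow> u = 0"
  proof (intro ballI impI)
    fix u assume "u \<in> quaternions" "a * u = u * - b"
    then show "u = 0"
      using inj_onD[OF bij_betw_imp_inj_on[OF bij], of u 0] quaternions_closed(1) by simp
  qed
next
  assume "\<forall>u\<in>quaternions. a * u = u * - b \<longrightarrow> u = 0"
  then show "bij_betw (\<lambda>x. a * x + x * b) quaternions quaternions"
    by (intro sylvester_bij_if_no_kernel a b) (auto simp: eq_neg_iff_add_eq_0)
qed

text \<open>
  An intertwining \<open>u\<close> with \<open>u\<^sup>s \<noteq> 0\<close> is a conjugation: \<open>a u = u (-b)\<close> says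
  \<open>a = h\<^sup>-\<^sup>1 (-b) h\<close> for \<open>h = u\<^sup>c\<close>, because \<open>u\<^sup>c\<close> is a scalar multiple of
  \<open>u\<^sup>-\<^sup>1\<close>.
\<close>

lemma conjugate_iff_invertible_intertwiner:
  "(\<exists>h\<in>quaternions. qtn_norm h \<noteq> 0 \<and>
      a = qtn_of (inverse (qtn_norm h)) * qtn_conj h * c * h) \<longleftrightarrow>
    (\<exists>u\<in>quaternions. qtn_norm u \<noteq> 0 \<and> a * u = u * c)" (is "?L \<longleftrightarrow> ?R")
proof
  assume ?L
  then obtain h where h: "h \<in> quaternions" "qtn_norm h \<noteq> 0"
    and a: "a = qtn_of (inverse (qtn_norm h)) * qtn_conj h * c * h"
    by blast
  have "a * qtn_conj h = qtn_of (inverse (qtn_norm h)) * qtn_conj h * c * (h * qtn_conj h)"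
    by (simp add: a mult.assoc)
  also have "\<dots> = qtn_of (inverse (qtn_norm h) * qtn_norm h) * (qtn_conj h * c)"
    unfolding qtn_mult_conj qtn_of_mult mult.assoc
    by (simp only: qtn_of_central[of "qtn_norm h" "qtn_conj h * c"] mult.assoc)
  finally have "a * qtn_conj h = qtn_conj h * c"
    using h by (simp add: qtn_of_1)
  with h show ?R
    by (metis qtn_norm_conj quaternions_closed(6))
next
  assume ?R
  then obtain u where u: "u \<in> quaternions" "qtn_norm u \<noteq> 0" "a * u = u * c"
    by blast
  have "qtn_of (inverse (qtn_norm u)) * u * c * qtn_conj u =
      qtn_of (inverse (qtn_norm u)) * a * (u * qtn_conj u)"
    by (simp add: mult.assoc u(3)[symmetric])
  also have "\<dots> = qtn_of (inverse (qtn_norm u) * qtn_norm u) * a"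
    unfolding qtn_mult_conj qtn_of_mult mult.assoc
    by (simp only: qtn_of_central[of "qtn_norm u" a])
  finally have "a = qtn_of (inverse (qtn_norm u)) * u * c * qtn_conj u"
    using u by (simp add: qtn_of_1)
  with u show ?L
    by (intro bexI[of _ "qtn_conj u"]) (simp_all add: qtn_norm_conj qtn_conj_conj quaternions_closed)
qed

end

section \<open>Slices of the quaternions\<close>

text \<open>
  The slice \<open>\<complex>\<^sub>J\<close> as a copy of the complex plane; for an imaginary unit \<open>J\<close> this is a ring
  homomorphism.
\<close>

definition emb :: "quat \<Rightarrow> complex \<Rightarrow> quat" where
  "emb J z = of_real (Re z) + J * of_real (Im z)"

text \<open>The point of the closed upper half plane that labels the sphere \<open>\<bbbS>\<^sub>q\<close>.\<close>

definition sphere_label :: "quat \<Rightarrow> complex" where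
  "sphere_label q = Complex (Req q) (sqrt (Im1 q ^ 2 + Im2 q ^ 2 + Im3 q ^ 2))"

text \<open>
  The part of the complex plane over which a circular set \<open>D\<close> lies. Every imaginary unit would define
  the same set, and it is invariant under complex conjugation.
\<close>

definition shadow :: "quat set \<Rightarrow> complex set" where
  "shadow D = {z. emb quat_i z \<in> D}"

lemma of_real_quat: "of_real r = Quat r 0 0 0"
  by (simp add: of_real_def scaleR_quat_def one_quat_def)

lemmas quat_simps = quat_eq_iff quat_ring_defs of_real_quat scaleR_quat_def quat_i_def

lemma imag_units_iff:
  "J \<in> imag_units \<longleftrightarrow> Req J = 0 \<and> Im1 J ^ 2 + Im2 J ^ 2 + Im3 J ^ 2 = 1"
proof
  assume "J \<in> imag_units"
  then have *: "Req J * Req J - Im1 J * Im1 J - Im2 J * Im2 J - Im3 J * Im3 J = - 1"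
    "Req J * Im1 J = 0" "Req J * Im2 J = 0" "Req J * Im3 J = 0"
    by (auto simp: imag_units_def power2_eq_square quat_simps)
  show "Req J = 0 \<and> Im1 J ^ 2 + Im2 J ^ 2 + Im3 J ^ 2 = 1"
  proof (cases "Req J = 0")
    case False
    with * have "Req J * Req J = - 1"
      by simp
    then show ?thesis
      by (metis neg_0_le_iff_le not_one_le_zero zero_le_square)
  qed (use * in \<open>simp add: power2_eq_square\<close>)
qed (auto simp: imag_units_def power2_eq_square quat_simps)

lemma imag_unit_square: "J \<in> imag_units \<Longrightarrow> J * J = - 1"
  by (simp add: imag_units_def power2_eq_square)

lemma quat_i_imag_unit: "quat_i \<in> imag_units"
  by (simp add: imag_units_iff quat_i_def)

lemma uminus_imag_unit: "J \<in> imag_units \<Longrightarrow> - J \<in> imag_units"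
  by (simp add: imag_units_def)

lemma conjugate_imag_unit:
  assumes "J \<in> imag_units" "p \<noteq> 0"
  shows "inverse p * J * p \<in> imag_units"
proof -
  have "(inverse p * J * p) * (inverse p * J * p) = inverse p * J * (p * inverse p) * J * p"
    by (simp only: mult.assoc)
  also have "\<dots> = inverse p * (J * J) * p"
    using assms by (simp add: mult.assoc)
  also have "\<dots> = - 1"
    using assms by (simp add: imag_unit_square)
  finally show ?thesis
    by (simp add: imag_units_def power2_eq_square)
qed

lemma emb_coords:
  assumes "J \<in> imag_units"
  shows "Req (emb J z) = Re z" "Im1 (emb J z) = Im1 J * Im z"
    "Im2 (emb J z) = Im2 J * Im z" "Im3 (emb J z) = Im3 J * Im z"
  using assms by (simp_all add: imag_units_iff emb_def quat_simps)

lemma emb_cnj: "emb J (cnj z) = emb (- J) z"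
  by (simp add: emb_def quat_simps)

lemma emb_mult: "J \<in> imag_units \<Longrightarrow> emb J (z * w) = emb J z * emb J w"
proof -
  assume J: "J \<in> imag_units"
  have "emb J z * emb J w = of_real (Re z * Re w) + J * of_real (Re z * Im w + Im z * Re w)
      + (J * J) * of_real (Im z * Im w)"
    by (simp add: emb_def quat_simps algebra_simps)
  also have "\<dots> = emb J (z * w)"
    unfolding imag_unit_square[OF J] by (simp add: emb_def quat_simps algebra_simps)
  finally show ?thesis
    by simp
qed

lemma emb_of_real: "emb J (of_real r) = of_real r"
  by (simp add: emb_def)

lemma emb_diff: "emb J (z - w) = emb J z - emb J w"
  by (simp add: emb_def quat_simps algebra_simps)

lemma emb_power: "J \<in> imag_units \<Longrightarrow> emb J (z ^ n) = emb J z ^ n"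
  by (induction n) (simp_all add: emb_mult emb_of_real[of J 1, simplified])

lemma sphere_label_emb:
  assumes "J \<in> imag_units"
  shows "sphere_label (emb J z) = Complex (Re z) \<bar>Im z\<bar>"
proof -
  have "(Im1 J * Im z)\<^sup>2 + (Im2 J * Im z)\<^sup>2 + (Im3 J * Im z)\<^sup>2 =
      (Im1 J ^ 2 + Im2 J ^ 2 + Im3 J ^ 2) * (Im z)\<^sup>2"
    by (simp add: algebra_simps power_mult_distrib)
  then show ?thesis
    using assms by (simp add: sphere_label_def emb_coords[OF assms] imag_units_iff)
qed

lemma sphere_label_emb_cases:
  assumes "J \<in> imag_units"
  obtains "sphere_label (emb J z) = z" | "sphere_label (emb J z) = cnj z"
  using sphere_label_emb[OF assms, of z] by (cases "Im z \<ge> 0") (auto simp: complex_eq_iff)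

lemma emb_sphere_label_ex: "\<exists>J\<in>imag_units. q = emb J (sphere_label q)"
proof (cases "Im1 q ^ 2 + Im2 q ^ 2 + Im3 q ^ 2 = 0")
  case True
  then have "Im1 q = 0" "Im2 q = 0" "Im3 q = 0"
    by (auto simp: add_nonneg_eq_0_iff)
  then have "q = emb quat_i (sphere_label q)"
    by (simp add: quat_eq_iff emb_coords[OF quat_i_imag_unit] sphere_label_def)
  then show ?thesis
    using quat_i_imag_unit by blast
next
  case False
  define s where "s = sqrt (Im1 q ^ 2 + Im2 q ^ 2 + Im3 q ^ 2)"
  have s2: "s ^ 2 = Im1 q ^ 2 + Im2 q ^ 2 + Im3 q ^ 2"
    by (simp add: s_def)
  have "s \<noteq> 0"
    using False by (simp add: s_def)
  define J where "J = Quat 0 (Im1 q / s) (Im2 q / s) (Im3 q / s)"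
  have "(Im1 q / s)\<^sup>2 + (Im2 q / s)\<^sup>2 + (Im3 q / s)\<^sup>2 = s ^ 2 / s ^ 2"
    by (simp only: power_divide flip: add_divide_distrib s2)
  with \<open>s \<noteq> 0\<close> have J: "J \<in> imag_units"
    by (simp add: J_def imag_units_iff)
  have "q = emb J (sphere_label q)"
    using \<open>s \<noteq> 0\<close> by (simp add: quat_eq_iff emb_coords[OF J])
      (simp add: J_def sphere_label_def flip: s_def)
  with J show ?thesis
    by blast
qed

lemma sphere_of_eq: "sphere_of q = {p. sphere_label p = sphere_label q}"
proof (intro equalityI subsetI)
  fix p assume "p \<in> sphere_of q"
  then obtain x y I J where "I \<in> imag_units" "J \<in> imag_units"
    "p = emb J (Complex x y)" "q = emb I (Complex x y)"
    by (auto simp: sphere_of_def emb_def)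
  then show "p \<in> {p. sphere_label p = sphere_label q}"
    by (simp add: sphere_label_emb)
next
  fix p assume "p \<in> {p. sphere_label p = sphere_label q}"
  moreover obtain I where "I \<in> imag_units" "q = emb I (sphere_label q)"
    using emb_sphere_label_ex by blast
  moreover obtain J where "J \<in> imag_units" "p = emb J (sphere_label p)"
    using emb_sphere_label_ex by blast
  ultimately show "p \<in> sphere_of q"
    unfolding sphere_of_def emb_def by force
qed

lemma circular_iff: "circular D \<longleftrightarrow> (\<forall>p q. q \<in> D \<longrightarrow> sphere_label p = sphere_label q \<longrightarrow> p \<in> D)"
  by (auto simp: circular_def sphere_of_eq)

lemma emb_in_circular_iff:
  assumes "circular D" "J \<in> imag_units"
  shows "emb J z \<in> D \<longleftrightarrow> z \<in> shadow D"
proof -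
  have "sphere_label (emb J z) = sphere_label (emb quat_i z)"
    by (simp add: sphere_label_emb assms quat_i_imag_unit)
  then show ?thesis
    using assms(1) unfolding circular_iff shadow_def by (metis mem_Collect_eq)
qed

lemma shadow_cnj_iff: "circular D \<Longrightarrow> cnj z \<in> shadow D \<longleftrightarrow> z \<in> shadow D"
  using emb_in_circular_iff[of D "- quat_i" z] uminus_imag_unit[OF quat_i_imag_unit]
  by (simp add: shadow_def emb_cnj)

lemma sphere_label_in_shadow_iff: "circular D \<Longrightarrow> sphere_label q \<in> shadow D \<longleftrightarrow> q \<in> D"
  by (metis emb_sphere_label_ex emb_in_circular_iff)

lemma shadow_Int: "shadow (D \<inter> E) = shadow D \<inter> shadow E"
  by (auto simp: shadow_def)

lemma shadow_mono: "D \<subseteq> E \<Longrightarrow> shadow D \<subseteq> shadow E"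
  by (auto simp: shadow_def)

lemma circular_Int: "circular D \<Longrightarrow> circular E \<Longrightarrow> circular (D \<inter> E)"
  by (auto simp: circular_def)

lemma continuous_on_emb: "continuous_on A (emb J)"
  unfolding emb_def by (intro continuous_intros)

lemma open_shadow: "open D \<Longrightarrow> open (shadow D)"
  using open_vimage[OF _ continuous_on_emb[of UNIV quat_i], of D] by (simp add: shadow_def vimage_def)

lemma bounded_linear_quat_coords:
  "bounded_linear Req" "bounded_linear Im1" "bounded_linear Im2" "bounded_linear Im3"
proof -
  have *: "bounded_linear \<kappa>" if "\<And>q. \<kappa> q = inner q e" for \<kappa> :: "quat \<Rightarrow> real" and e
    using bounded_linear_inner_left[of e] by (simp add: that[abs_def])
  show "bounded_linear Req"
    by (rule *[of _ 1]) (simp add: inner_quat_def one_quat_def)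
  show "bounded_linear Im1"
    by (rule *[of _ "Quat 0 1 0 0"]) (simp add: inner_quat_def)
  show "bounded_linear Im2"
    by (rule *[of _ "Quat 0 0 1 0"]) (simp add: inner_quat_def)
  show "bounded_linear Im3"
    by (rule *[of _ "Quat 0 0 0 1"]) (simp add: inner_quat_def)
qed

lemma continuous_on_sphere_label: "continuous_on A sphere_label"
proof -
  have "continuous_on A \<kappa>" if "bounded_linear \<kappa>" for \<kappa> :: "quat \<Rightarrow> real"
    using that by (rule linear_continuous_on)
  note * = this[OF bounded_linear_quat_coords(1)] this[OF bounded_linear_quat_coords(2)]
    this[OF bounded_linear_quat_coords(3)] this[OF bounded_linear_quat_coords(4)]
  show ?thesis
    unfolding sphere_label_def Complex_eq by (intro continuous_intros *)
qed

lemma open_sphere_label_vimage: "open W \<Longrightarrow> open {q. sphere_label q \<in> W}"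
  using open_vimage[OF _ continuous_on_sphere_label[of UNIV], of W] by (simp add: vimage_def)

text \<open>The characteristic polynomial of \<open>p\<close>, read in a slice.\<close>

lemma Delta_emb:
  assumes "J \<in> imag_units"
  shows "Delta p (emb J w) = emb J ((w - sphere_label p) * (w - cnj (sphere_label p)))"
proof -
  let ?z = "sphere_label p"
  have "(norm p)\<^sup>2 = (Re ?z)\<^sup>2 + (Im ?z)\<^sup>2"
    by (simp add: norm_quat_def inner_quat_def sphere_label_def power2_eq_square)
  then have "(w - ?z) * (w - cnj ?z) = w ^ 2 - of_real (2 * Req p) * w + of_real ((norm p)\<^sup>2)"
    by (simp add: complex_eq_iff power2_eq_square sphere_label_def algebra_simps)
  moreover have "emb J (x + y) = emb J x + emb J y" for x y
    by (simp add: emb_def quat_simps algebra_simps)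
  ultimately show ?thesis
    by (simp only: Delta_def emb_diff emb_mult[OF assms] emb_power[OF assms] emb_of_real)
qed

section \<open>Stem functions\<close>

definition qtn_Re :: "complex qtn \<Rightarrow> quat" where
  "qtn_Re b = Quat (Re (comp0 b)) (Re (comp1 b)) (Re (comp2 b)) (Re (comp3 b))"

definition qtn_Im :: "complex qtn \<Rightarrow> quat" where
  "qtn_Im b = Quat (Im (comp0 b)) (Im (comp1 b)) (Im (comp2 b)) (Im (comp3 b))"

definition qtn_pair :: "quat \<Rightarrow> quat \<Rightarrow> complex qtn" where
  "qtn_pair p q = Qtn (Complex (Req p) (Req q)) (Complex (Im1 p) (Im1 q))
     (Complex (Im2 p) (Im2 q)) (Complex (Im3 p) (Im3 q))"

definition slice_eval :: "quat \<Rightarrow> complex qtn \<Rightarrow> quat" where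
  "slice_eval J b = qtn_Re b + J * qtn_Im b"

text \<open>
  The stem function \<open>F\<^sub>1 + \<i> F\<^sub>2\<close>, read off from the single slice \<open>\<complex>\<^sub>i\<close> by solving
  \<open>f (x + i y) = F\<^sub>1 + i F\<^sub>2\<close> and \<open>f (x - i y) = F\<^sub>1 - i F\<^sub>2\<close>. Defined in this way for every
  \<open>f\<close>, it always commutes with complex conjugation.
\<close>

definition stem :: "(quat \<Rightarrow> quat) \<Rightarrow> complex \<Rightarrow> complex qtn" where
  "stem f z =
     (let p = f (emb quat_i z); m = f (emb (- quat_i) z)
      in qtn_pair ((1 / 2) *\<^sub>R (p + m)) ((1 / 2) *\<^sub>R (quat_i * (m - p))))"

lemmas stem_simps = qtn_Re_def qtn_Im_def qtn_pair_def slice_eval_def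

lemma qtn_pair_eqI: "qtn_Re b = p \<Longrightarrow> qtn_Im b = q \<Longrightarrow> b = qtn_pair p q"
  by (cases b) (auto simp: stem_simps)

lemma slice_eval_stem:
  "slice_eval quat_i (stem f z) = f (emb quat_i z)"
  "slice_eval (- quat_i) (stem f z) = f (emb (- quat_i) z)"
  by (simp_all add: stem_def Let_def stem_simps quat_simps field_simps)

lemma stem_eqI:
  assumes "f (emb quat_i z) = slice_eval quat_i b" "f (emb (- quat_i) z) = slice_eval (- quat_i) b"
  shows "stem f z = b"
  unfolding stem_def Let_def assms
  by (rule qtn_pair_eqI[symmetric]) (simp_all add: stem_simps quat_simps)

lemma slice_eval_cnj: "slice_eval J (map_qtn cnj b) = slice_eval (- J) b"
  by (simp add: stem_simps qtn.map_sel quat_simps)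

lemma stem_cnj: "stem f (cnj z) = map_qtn cnj (stem f z)"
  by (rule stem_eqI) (simp_all add: emb_cnj slice_eval_cnj slice_eval_stem)

lemma slice_eval_add: "slice_eval J (a + b) = slice_eval J a + slice_eval J b"
  by (simp add: stem_simps qtn_ring_defs quat_simps algebra_simps)

lemma slice_eval_mult:
  assumes "J \<in> imag_units"
  shows "slice_eval J (a * b) = slice_eval J a * qtn_Re b + J * slice_eval J a * qtn_Im b"
proof -
  have "slice_eval J a * qtn_Re b + J * slice_eval J a * qtn_Im b =
      (qtn_Re a * qtn_Re b + (J * J) * qtn_Im a * qtn_Im b) + J * (qtn_Im a * qtn_Re b + qtn_Re a * qtn_Im b)"
    by (simp add: slice_eval_def algebra_simps mult.assoc)
  moreover have "qtn_Re (a * b) = qtn_Re a * qtn_Re b - qtn_Im a * qtn_Im b"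
    "qtn_Im (a * b) = qtn_Im a * qtn_Re b + qtn_Re a * qtn_Im b"
    by (simp_all add: stem_simps qtn_ring_defs quat_simps algebra_simps)
  ultimately show ?thesis
    using imag_unit_square[OF assms] by (simp add: slice_eval_def)
qed

lemma slice_eval_scale:
  assumes "J \<in> imag_units"
  shows "slice_eval J (qtn_of c * b) = emb J c * slice_eval J b"
proof -
  have *: "slice_eval J (qtn_of c) = emb J c"
    by (simp add: stem_simps emb_def qtn_of_def quat_simps)
  have "emb J c * J = J * emb J c"
    by (simp add: emb_def quat_simps algebra_simps)
  then show ?thesis
    unfolding slice_eval_mult[OF assms] *
    by (simp add: slice_eval_def distrib_left mult.assoc[symmetric])
qed

lemma quat_of_real_commute: "of_real r * p = p * of_real r" for p :: quat
  by (simp add: quat_simps)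

text \<open>
  For \<open>p = f q \<noteq> 0\<close> with \<open>q = x + J y\<close>, the point \<open>p\<^sup>-\<^sup>1 q p\<close> is \<open>x + I y\<close> on the same sphere, with
  \<open>I = p\<^sup>-\<^sup>1 J p\<close>. Hence \<open>p (G\<^sub>1 + I G\<^sub>2) = p G\<^sub>1 + J p G\<^sub>2\<close>, which is the value at \<open>J\<close> of the product of
  the stem functions. This expression also vanishes with \<open>p\<close>, which matches the first case in the
  definition of the star product.
\<close>

lemma star_slice_eval:
  assumes J: "J \<in> imag_units"
    and f: "f (emb J z) = slice_eval J a"
    and g: "\<And>I. I \<in> imag_units \<Longrightarrow> g (emb I z) = slice_eval I b"
  shows "star f g (emb J z) = slice_eval J (a * b)"
proof (cases "slice_eval J a = 0")
  case True
  then show ?thesis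
    by (simp add: star_def f slice_eval_mult[OF J])
next
  case False
  let ?p = "slice_eval J a"
  let ?I = "inverse ?p * J * ?p"
  have "inverse ?p * emb J z * ?p = (inverse ?p * ?p) * of_real (Re z) + ?I * of_real (Im z)"
    by (simp add: emb_def distrib_left distrib_right mult.assoc quat_of_real_commute)
  with False have "inverse ?p * emb J z * ?p = emb ?I z"
    by (simp add: emb_def)
  then have "star f g (emb J z) = ?p * slice_eval ?I b"
    using False by (simp add: star_def f g conjugate_imag_unit[OF J])
  also have "\<dots> = ?p * qtn_Re b + (?p * inverse ?p) * J * ?p * qtn_Im b"
    unfolding slice_eval_def[of "inverse ?p * J * ?p"] by (simp only: distrib_left mult.assoc)
  also have "\<dots> = slice_eval J (a * b)"
    using False by (simp add: slice_eval_mult[OF J])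
  finally show ?thesis .
qed

text \<open>
  Analytic properties of functions with values in the complexified quaternions are imposed on the
  four components, so that complex analysis applies without a topology on those values.
\<close>

definition compwise :: "((complex \<Rightarrow> 'a) \<Rightarrow> bool) \<Rightarrow> (complex \<Rightarrow> 'a qtn) \<Rightarrow> bool" where
  "compwise P F \<longleftrightarrow> P (\<lambda>z. comp0 (F z)) \<and> P (\<lambda>z. comp1 (F z)) \<and> P (\<lambda>z. comp2 (F z)) \<and> P (\<lambda>z. comp3 (F z))"

lemma compwise_iff: "compwise P F \<longleftrightarrow> (\<forall>c\<in>{comp0, comp1, comp2, comp3}. P (\<lambda>z. c (F z)))"
  by (auto simp: compwise_def)

text \<open>
  On \<open>D\<close>, the function \<open>f\<close> comes from its stem function: this is the representation formula,
  by which \<open>f\<close> is determined by its restriction to one slice.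
\<close>

definition sliced_on :: "quat set \<Rightarrow> (quat \<Rightarrow> quat) \<Rightarrow> bool" where
  "sliced_on D f \<longleftrightarrow> (\<forall>J\<in>imag_units. \<forall>z\<in>shadow D. f (emb J z) = slice_eval J (stem f z))"

lemma bounded_linear_quat_mult_left: "bounded_linear (\<lambda>q. c * q)" for c :: quat
  by (rule bounded_linear_mult_right)

text \<open>
  Let \<open>P, Q\<close> and \<open>P', Q'\<close> be the partial derivatives of \<open>f\<close> along the slices of \<open>i\<close> and \<open>- i\<close>.
  Regularity gives one quaternionic equation in each of these two slices; together they say that the
  differential of every component of the stem function is complex linear.
\<close>

lemma cauchy_riemann_complexify:
  fixes P Q P' Q' :: quat and \<kappa> :: "quat \<Rightarrow> real"
  assumes "P + quat_i * Q = 0" "P' - quat_i * Q' = 0"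
    and "\<kappa> \<in> {Req, Im1, Im2, Im3}"
  shows "Complex (\<kappa> ((1 / 2) *\<^sub>R ((x *\<^sub>R P + y *\<^sub>R Q) + (x *\<^sub>R P' + y *\<^sub>R Q'))))
      (\<kappa> ((1 / 2) *\<^sub>R (quat_i * ((x *\<^sub>R P' + y *\<^sub>R Q') - (x *\<^sub>R P + y *\<^sub>R Q))))) =
    Complex (\<kappa> ((1 / 2) *\<^sub>R (P + P'))) (\<kappa> ((1 / 2) *\<^sub>R (quat_i * (P' - P)))) * Complex x y"
proof -
  have "Req P = Im1 Q" "Im1 P = - Req Q" "Im2 P = Im3 Q" "Im3 P = - Im2 Q"
    "Req P' = - Im1 Q'" "Im1 P' = Req Q'" "Im2 P' = - Im3 Q'" "Im3 P' = Im2 Q'"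
    using assms(1,2) by (auto simp: quat_simps)
  then show ?thesis
    using assms(3) by (auto simp: complex_eq_iff quat_simps field_simps)
qed

text \<open>
  Each component of the stem function is a fixed real linear expression in \<open>f (x + i y)\<close> and
  \<open>f (x - i y)\<close>, so it is real differentiable, and its differential is multiplication by a complex number.
\<close>

lemma slice_regular_imp_holomorphic_stem:
  assumes D: "open D" "circular D" and f: "slice_regular_on D f"
  shows "sliced_on D f" "compwise (\<lambda>h. h holomorphic_on shadow D) (stem f)"
proof -
  obtain F1 F2 where F: "\<And>I x y. I \<in> imag_units \<Longrightarrow> of_real x + I * of_real y \<in> D \<Longrightarrow>
        f (of_real x + I * of_real y) = F1 x y + I * F2 x y"
    using f unfolding slice_regular_on_def by metis
  show "sliced_on D f"
    unfolding sliced_on_def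
  proof (intro ballI)
    fix J z assume J: "J \<in> imag_units" and z: "z \<in> shadow D"
    have *: "f (emb I z) = slice_eval I (qtn_pair (F1 (Re z) (Im z)) (F2 (Re z) (Im z)))"
      if "I \<in> imag_units" for I
      using F[OF that, of "Re z" "Im z"] z emb_in_circular_iff[OF D(2) that, of z]
      by (simp add: emb_def slice_eval_def qtn_Re_def qtn_Im_def qtn_pair_def)
    have "stem f z = qtn_pair (F1 (Re z) (Im z)) (F2 (Re z) (Im z))"
      by (rule stem_eqI) (simp_all add: * quat_i_imag_unit uminus_imag_unit)
    then show "f (emb J z) = slice_eval J (stem f z)"
      using * J by simp
  qed
  have "\<exists>c'. ((\<lambda>z. Complex (\<kappa> (qtn_Re (stem f z))) (\<kappa> (qtn_Im (stem f z)))) has_field_derivative c') (at z)"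
    if z: "z \<in> shadow D" and \<kappa>: "\<kappa> \<in> {Req, Im1, Im2, Im3}" for z \<kappa>
  proof -
    have reg: "\<exists>A. ((\<lambda>(u, v). f (of_real u + I * of_real v)) has_derivative A) (at (Re z, Im z)) \<and>
        A (1, 0) + I * A (0, 1) = 0" if I: "I \<in> imag_units" for I
    proof -
      have "of_real (Re z) + I * of_real (Im z) \<in> D"
        using z emb_in_circular_iff[OF D(2) I, of z] by (simp add: emb_def)
      then obtain A where "((\<lambda>(u, v). f (of_real u + I * of_real v)) has_derivative A) (at (Re z, Im z))"
        "(1 / 2) *\<^sub>R (A (1, 0) + I * A (0, 1)) = 0"
        using f I unfolding slice_regular_on_def by blast
      then show ?thesis
        by auto
    qed
    obtain A where
      A: "((\<lambda>(u, v). f (of_real u + quat_i * of_real v)) has_derivative A) (at (Re z, Im z))"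
        "A (1, 0) + quat_i * A (0, 1) = 0"
      using reg[OF quat_i_imag_unit] by blast
    obtain B where
      B: "((\<lambda>(u, v). f (of_real u + (- quat_i) * of_real v)) has_derivative B) (at (Re z, Im z))"
        "B (1, 0) - quat_i * B (0, 1) = 0"
      using reg[OF uminus_imag_unit[OF quat_i_imag_unit]] by auto
    have lin: "((\<lambda>w. (Re w, Im w)) has_derivative (\<lambda>w. (Re w, Im w))) (at z)"
      by (intro has_derivative_Pair bounded_linear_imp_has_derivative bounded_linear_Re bounded_linear_Im)
    have dA: "((\<lambda>w. f (emb quat_i w)) has_derivative (\<lambda>w. A (Re w, Im w))) (at z)"
      using has_derivative_compose[OF lin, of "\<lambda>(u, v). f (of_real u + quat_i * of_real v)" A] A(1)
      by (simp add: emb_def)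
    have dB: "((\<lambda>w. f (emb (- quat_i) w)) has_derivative (\<lambda>w. B (Re w, Im w))) (at z)"
      using has_derivative_compose[OF lin, of "\<lambda>(u, v). f (of_real u + (- quat_i) * of_real v)" B] B(1)
      by (simp add: emb_def)
    have split: "L (x, y) = x *\<^sub>R L (1, 0) + y *\<^sub>R L (0, 1)"
      if "bounded_linear L" for L :: "real \<times> real \<Rightarrow> quat" and x y
      using linear_add[OF bounded_linear.linear[OF that], of "x *\<^sub>R (1, 0)" "y *\<^sub>R (0, 1)"]
        linear_scale[OF bounded_linear.linear[OF that], of x "(1, 0)"]
        linear_scale[OF bounded_linear.linear[OF that], of y "(0, 1)"] by simp
    note splitA = split[OF has_derivative_bounded_linear[OF A(1)]]
    note splitB = split[OF has_derivative_bounded_linear[OF B(1)]]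
    have bl: "bounded_linear \<kappa>"
      using \<kappa> bounded_linear_quat_coords by auto
    have d1: "((\<lambda>w. \<kappa> ((1 / 2) *\<^sub>R (f (emb quat_i w) + f (emb (- quat_i) w)))) has_derivative
        (\<lambda>w. \<kappa> ((1 / 2) *\<^sub>R (A (Re w, Im w) + B (Re w, Im w))))) (at z)"
      by (intro bounded_linear.has_derivative[OF bl] has_derivative_scaleR_right has_derivative_add dA dB)
    have d2: "((\<lambda>w. \<kappa> ((1 / 2) *\<^sub>R (quat_i * (f (emb (- quat_i) w) - f (emb quat_i w))))) has_derivative
        (\<lambda>w. \<kappa> ((1 / 2) *\<^sub>R (quat_i * (B (Re w, Im w) - A (Re w, Im w)))))) (at z)"
      by (intro bounded_linear.has_derivative[OF bl] has_derivative_scaleR_right has_derivative_diff dA dB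
          bounded_linear.has_derivative[OF bounded_linear_quat_mult_left])
    have "((\<lambda>w. Complex (\<kappa> ((1 / 2) *\<^sub>R (f (emb quat_i w) + f (emb (- quat_i) w))))
          (\<kappa> ((1 / 2) *\<^sub>R (quat_i * (f (emb (- quat_i) w) - f (emb quat_i w)))))) has_derivative
        (\<lambda>w. Complex (\<kappa> ((1 / 2) *\<^sub>R (A (Re w, Im w) + B (Re w, Im w))))
          (\<kappa> ((1 / 2) *\<^sub>R (quat_i * (B (Re w, Im w) - A (Re w, Im w))))))) (at z)"
      unfolding Complex_eq
      by (intro has_derivative_add has_derivative_mult_right has_derivative_of_real d1 d2)
    also have "(\<lambda>w. Complex (\<kappa> ((1 / 2) *\<^sub>R (A (Re w, Im w) + B (Re w, Im w))))
          (\<kappa> ((1 / 2) *\<^sub>R (quat_i * (B (Re w, Im w) - A (Re w, Im w)))))) =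
        (*) (Complex (\<kappa> ((1 / 2) *\<^sub>R (A (1, 0) + B (1, 0)))) (\<kappa> ((1 / 2) *\<^sub>R (quat_i * (B (1, 0) - A (1, 0))))))"
    proof
      fix w
      show "Complex (\<kappa> ((1 / 2) *\<^sub>R (A (Re w, Im w) + B (Re w, Im w))))
          (\<kappa> ((1 / 2) *\<^sub>R (quat_i * (B (Re w, Im w) - A (Re w, Im w))))) =
        Complex (\<kappa> ((1 / 2) *\<^sub>R (A (1, 0) + B (1, 0)))) (\<kappa> ((1 / 2) *\<^sub>R (quat_i * (B (1, 0) - A (1, 0))))) * w"
        using cauchy_riemann_complexify[OF A(2) B(2) \<kappa>, of "Re w" "Im w"]
        unfolding splitA[of "Re w" "Im w"] splitB[of "Re w" "Im w"] by simp
    qed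
    finally show ?thesis
      unfolding has_field_derivative_def stem_def Let_def qtn_Re_def qtn_Im_def qtn_pair_def
      by auto
  qed
  note deriv = this
  show "compwise (\<lambda>h. h holomorphic_on shadow D) (stem f)"
    unfolding compwise_def holomorphic_on_open[OF open_shadow[OF D(1)]]
    using deriv[of _ Req] deriv[of _ Im1] deriv[of _ Im2] deriv[of _ Im3]
    by (simp add: qtn_Re_def qtn_Im_def)
qed

text \<open>
  Multiplying the complex derivative of the stem function by \<open>\<i>\<close> and evaluating at \<open>I\<close> is the
  same as multiplying by \<open>I\<close> after evaluation, so \<open>\<partial>\<^sub>y f = I (\<partial>\<^sub>x f)\<close> in the slice of \<open>I\<close>, which is the
  regularity equation.
\<close>

lemma holomorphic_stem_imp_slice_regular:
  assumes D: "open D" "circular D" and f: "sliced_on D f"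
    and hol: "compwise (\<lambda>h. h holomorphic_on shadow D) (stem f)"
  shows "slice_regular_on D f"
proof -
  have *: "f (of_real x + I * of_real y) = qtn_Re (stem f (Complex x y)) + I * qtn_Im (stem f (Complex x y))"
    if "I \<in> imag_units" "of_real x + I * of_real y \<in> D" for I x y
    using f[unfolded sliced_on_def, rule_format, OF that(1), of "Complex x y"] that
      emb_in_circular_iff[OF D(2) that(1), of "Complex x y"]
    by (simp add: emb_def slice_eval_def)
  have parity: "qtn_Re (stem f (Complex x (- y))) = qtn_Re (stem f (Complex x y))"
    "qtn_Im (stem f (Complex x (- y))) = - qtn_Im (stem f (Complex x y))" for x y
    using stem_cnj[of f "Complex x y", unfolded cnj.code complex.sel]
    by (simp_all add: qtn_Re_def qtn_Im_def qtn.map_sel quat_simps)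
  have "\<exists>A. ((\<lambda>(u, v). f (of_real u + I * of_real v)) has_derivative A) (at (x, y)) \<and>
      (1 / 2) *\<^sub>R (A (1, 0) + I * A (0, 1)) = 0"
    if I: "I \<in> imag_units" and xy: "of_real x + I * of_real y \<in> D" for I x y
  proof -
    let ?z = "Complex x y"
    have z: "?z \<in> shadow D"
      using emb_in_circular_iff[OF D(2) I, of ?z] xy by (simp add: emb_def)
    obtain a b c d where der:
      "((\<lambda>w. comp0 (stem f w)) has_field_derivative a) (at ?z)"
      "((\<lambda>w. comp1 (stem f w)) has_field_derivative b) (at ?z)"
      "((\<lambda>w. comp2 (stem f w)) has_field_derivative c) (at ?z)"
      "((\<lambda>w. comp3 (stem f w)) has_field_derivative d) (at ?z)"
      using hol z unfolding compwise_def holomorphic_on_open[OF open_shadow[OF D(1)]] by blast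
    have lin: "((\<lambda>(u, v). Complex u v) has_derivative (\<lambda>(u, v). Complex u v)) (at (x, y))"
      unfolding Complex_eq case_prod_unfold
      by (auto intro!: derivative_eq_intros)
    have parts: "((\<lambda>p. Re (h (case p of (u, v) \<Rightarrow> Complex u v))) has_derivative
          (\<lambda>p. Re (h' * (case p of (u, v) \<Rightarrow> Complex u v)))) (at (x, y))"
        "((\<lambda>p. Im (h (case p of (u, v) \<Rightarrow> Complex u v))) has_derivative
          (\<lambda>p. Im (h' * (case p of (u, v) \<Rightarrow> Complex u v)))) (at (x, y))"
      if "(h has_field_derivative h') (at ?z)" for h h'
    proof -
      have *: "((\<lambda>p. h (case p of (u, v) \<Rightarrow> Complex u v)) has_derivative
          (\<lambda>p. h' * (case p of (u, v) \<Rightarrow> Complex u v))) (at (x, y))"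
        using has_derivative_compose[OF lin, of h "(*) h'"] that
        by (simp add: has_field_derivative_def)
      show "((\<lambda>p. Re (h (case p of (u, v) \<Rightarrow> Complex u v))) has_derivative
          (\<lambda>p. Re (h' * (case p of (u, v) \<Rightarrow> Complex u v)))) (at (x, y))"
        "((\<lambda>p. Im (h (case p of (u, v) \<Rightarrow> Complex u v))) has_derivative
          (\<lambda>p. Im (h' * (case p of (u, v) \<Rightarrow> Complex u v)))) (at (x, y))"
        by (intro bounded_linear.has_derivative[OF bounded_linear_Re] bounded_linear.has_derivative[OF bounded_linear_Im] * )+
    qed
    have basis: "Quat r s t v = r *\<^sub>R 1 + s *\<^sub>R quat_i + t *\<^sub>R quat_j + v *\<^sub>R quat_k" for r s t v
      by (simp add: quat_simps quat_j_def quat_k_def)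
    define A where "A = (\<lambda>p. case p of (u, v) \<Rightarrow> slice_eval I (Qtn (a * Complex u v) (b * Complex u v) (c * Complex u v) (d * Complex u v)))"
    have dA: "((\<lambda>p. slice_eval I (stem f (case p of (u, v) \<Rightarrow> Complex u v))) has_derivative A) (at (x, y))"
      unfolding A_def slice_eval_def qtn_Re_def qtn_Im_def case_prod_unfold qtn.sel basis
      by (intro has_derivative_add has_derivative_scaleR_left
          bounded_linear.has_derivative[OF bounded_linear_quat_mult_left]
          der[THEN parts(1), unfolded case_prod_unfold] der[THEN parts(2), unfolded case_prod_unfold])
    have op: "open {p. (case p of (u, v) \<Rightarrow> Complex u v) \<in> shadow D}"
    proof -
      have "continuous_on UNIV (\<lambda>p. case p of (u, v) \<Rightarrow> Complex u v)"
        unfolding Complex_eq case_prod_unfold by (intro continuous_intros)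
      from open_vimage[OF open_shadow[OF D(1)] this] show ?thesis
        by (simp add: vimage_def)
    qed
    have "((\<lambda>(u, v). f (of_real u + I * of_real v)) has_derivative A) (at (x, y))"
    proof (rule has_derivative_transform_within_open[OF dA op])
      fix p assume "p \<in> {p. (case p of (u, v) \<Rightarrow> Complex u v) \<in> shadow D}"
      then show "slice_eval I (stem f (case p of (u, v) \<Rightarrow> Complex u v)) =
          (case p of (u, v) \<Rightarrow> f (of_real u + I * of_real v))"
        using f[unfolded sliced_on_def, rule_format, OF I, of "Complex (fst p) (snd p)"]
        by (auto simp: emb_def case_prod_unfold)
    qed (use z in simp)
    moreover have "A (1, 0) + I * A (0, 1) = 0"
    proof -
      have "I * A (0, 1) = I * qtn_Re (Qtn (a * \<i>) (b * \<i>) (c * \<i>) (d * \<i>)) + (I * I) * qtn_Im (Qtn (a * \<i>) (b * \<i>) (c * \<i>) (d * \<i>))"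
        by (simp add: A_def slice_eval_def distrib_left mult.assoc flip: imaginary_unit.code)
      then show ?thesis
        unfolding imag_unit_square[OF I]
        by (simp add: A_def slice_eval_def qtn_Re_def qtn_Im_def quat_simps)
    qed
    ultimately show ?thesis
      by auto
  qed
  then show ?thesis
    unfolding slice_regular_on_def
    using * parity by (intro conjI exI[of _ "\<lambda>x y. qtn_Re (stem f (Complex x y))"] exI[of _ "\<lambda>x y. qtn_Im (stem f (Complex x y))"]) auto
qed

section \<open>Symmetric meromorphic functions\<close>

text \<open>
  Components of stem functions have this property; it holds at every point, poles included, so it
  survives sums, products and pointwise inverses.
\<close>

definition symmetric :: "(complex \<Rightarrow> complex) \<Rightarrow> bool" where
  "symmetric h \<longleftrightarrow> (\<forall>z. h (cnj z) = cnj (h z))"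

lemma tendsto_symmetric:
  assumes "symmetric h" "h \<midarrow>z\<rightarrow> c"
  shows "h \<midarrow>cnj z\<rightarrow> cnj c"
proof -
  have iso: "dist (cnj x) (cnj y) = dist x y" for x y
    by (simp add: dist_norm flip: complex_cnj_diff)
  show ?thesis
    unfolding LIM_def
  proof (intro allI impI)
    fix r :: real assume "r > 0"
    then obtain s where s: "s > 0" "\<And>x. x \<noteq> z \<Longrightarrow> dist x z < s \<Longrightarrow> dist (h x) c < r"
      using assms(2) unfolding LIM_def by blast
    have "dist (h x) (cnj c) < r" if "x \<noteq> cnj z" "dist x (cnj z) < s" for x
    proof -
      have "dist (h (cnj x)) c < r"
        using that iso[of x "cnj z"] by (intro s(2)) (auto simp: complex_eq_iff)
      moreover have "h (cnj x) = cnj (h x)"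
        using assms(1) by (simp add: symmetric_def)
      ultimately show ?thesis
        using iso[of "h x" "cnj c"] by simp
    qed
    with s(1) show "\<exists>s>0. \<forall>x. x \<noteq> cnj z \<and> dist x (cnj z) < s \<longrightarrow> dist (h x) (cnj c) < r"
      by blast
  qed
qed

lemma symmetric_remove_sings:
  assumes "symmetric h"
  shows "symmetric (remove_sings h)"
  unfolding symmetric_def
proof
  fix z
  show "remove_sings h (cnj z) = cnj (remove_sings h z)"
  proof (cases "\<exists>c. h \<midarrow>z\<rightarrow> c")
    case True
    then obtain c where "h \<midarrow>z\<rightarrow> c" ..
    with tendsto_symmetric[OF assms this] show ?thesis
      by (simp add: remove_sings_eqI)
  next
    case False
    then have "\<not> (\<exists>c. h \<midarrow>cnj z\<rightarrow> c)"
      using tendsto_symmetric[OF assms, where z = "cnj z"] by auto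
    with False show ?thesis
      by (simp add: remove_sings_def)
  qed
qed

lemma analytic_symmetric:
  assumes "symmetric h" "h analytic_on {z}"
  shows "h analytic_on {cnj z}"
proof -
  obtain S where S: "open S" "z \<in> S" "h holomorphic_on S"
    using assms(2) by (auto simp: analytic_at)
  have img: "cnj ` (cnj ` S) = S"
    by (simp add: image_image)
  have "cnj ` S = cnj -` S"
    by (auto simp: image_iff) (metis complex_cnj_cnj)
  then have op: "open (cnj ` S)"
    using open_vimage[OF S(1), of cnj] by (simp add: continuous_on_cnj)
  have "cnj \<circ> h \<circ> cnj holomorphic_on cnj ` S"
    by (rule holomorphic_on_compose_cnj_cnj) (simp_all add: img S op)
  moreover have "cnj \<circ> h \<circ> cnj = h"
    using assms(1) by (auto simp: symmetric_def)
  ultimately show ?thesis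
    using op S(2) by (auto simp: analytic_at)
qed

lemma eventually_symmetric:
  assumes "symmetric h" "eventually (\<lambda>w. h w = 0) (at z)"
  shows "eventually (\<lambda>w. h w = 0) (at (cnj z))"
proof -
  obtain S where S: "open S" "z \<in> S" "\<And>w. w \<in> S \<Longrightarrow> w \<noteq> z \<Longrightarrow> h w = 0"
    using assms(2) unfolding eventually_at_topological by blast
  have "open (cnj -` S)"
    using open_vimage[OF S(1), of cnj] by (simp add: continuous_on_cnj)
  moreover have "h w = 0" if "w \<in> cnj -` S" "w \<noteq> cnj z" for w
  proof -
    have "h (cnj w) = 0"
      using that by (intro S(3)) (auto simp: complex_eq_iff)
    then show ?thesis
      using assms(1) by (simp add: symmetric_def)
  qed
  ultimately show ?thesis
    using S(2) unfolding eventually_at_topological by (intro exI[of _ "cnj -` S"]) auto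
qed

lemma eventually_at_imp_open:
  fixes z :: "'a::t1_space"
  assumes "eventually P (at z)"
  obtains S where "open S" "z \<in> S" "\<And>w. w \<in> S \<Longrightarrow> eventually P (at w)"
proof -
  obtain S where S: "open S" "z \<in> S" "\<And>w. w \<in> S \<Longrightarrow> w \<noteq> z \<Longrightarrow> P w"
    using assms unfolding eventually_at_topological by blast
  have "eventually P (at w)" if "w \<in> S" for w
  proof (cases "w = z")
    case False
    have "eventually (\<lambda>v. v \<in> S - {z}) (at w)"
      using that False by (intro eventually_at_in_open'[OF open_delete[OF S(1)]]) auto
    then show ?thesis
      by eventually_elim (use S in auto)
  qed (use assms in simp)
  with S that show ?thesis
    by blast
qed

text \<open>
  Beyond the order of the pole the Laurent series has no negative exponents.
\<close>

lemma meromorphic_times_power_tendsto: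
  assumes "h meromorphic_on {z}"
  shows "\<exists>n. \<forall>m\<ge>n. \<exists>L. (\<lambda>w. (w - z) ^ m * h w) \<midarrow>z\<rightarrow> L"
proof -
  obtain F where F: "(\<lambda>w. h (z + w)) has_laurent_expansion F"
    using assms by (auto simp: meromorphic_on_def)
  define n where "n = nat (- fls_subdegree F)"
  have "\<exists>L. (\<lambda>w. (w - z) ^ m * h w) \<midarrow>z\<rightarrow> L" if "m \<ge> n" for m
  proof -
    let ?G = "fls_X_intpow (int m) * F"
    have "(\<lambda>w. (z + w - z) ^ m * h (z + w)) has_laurent_expansion ?G"
      using has_laurent_expansion_mult[OF has_laurent_expansion_fps_X_power F] by simp
    moreover have "fls_subdegree ?G \<ge> 0"
    proof (cases "F = 0")
      case False
      then show ?thesis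
        using that by (simp add: n_def)
    qed simp
    ultimately show ?thesis
      using has_laurent_expansion_imp_tendsto[of "\<lambda>w. (w - z) ^ m * h w" z] by blast
  qed
  then show ?thesis
    by blast
qed

section \<open>Semi-regular functions through their stem functions\<close>

lemma stem_comp_symmetric:
  assumes "c \<in> {comp0, comp1, comp2, comp3}"
  shows "symmetric (\<lambda>z. c (stem f z))"
  using assms by (auto simp: symmetric_def stem_cnj qtn.map_sel)

text \<open>
  The inverse of taking stem functions. At real points the choice of \<open>J\<close> is arbitrary, but there a symmetric
  \<open>F\<close> is real and \<open>J\<close> does not enter the value.
\<close>

definition unstem :: "(complex \<Rightarrow> complex qtn) \<Rightarrow> quat \<Rightarrow> quat" where
  "unstem F q =
     slice_eval (SOME J. J \<in> imag_units \<and> q = emb J (sphere_label q)) (F (sphere_label q))"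

lemma unstem_emb:
  assumes F: "compwise symmetric F" and J: "J \<in> imag_units"
  shows "unstem F (emb J z) = slice_eval J (F z)"
proof -
  have sym: "F (cnj z) = map_qtn cnj (F z)" for z
    using F by (simp add: compwise_def symmetric_def qtn_eq_iff qtn.map_sel)
  define I where "I = (SOME J'. J' \<in> imag_units \<and> emb J z = emb J' (sphere_label (emb J z)))"
  have I: "I \<in> imag_units" "emb J z = emb I (sphere_label (emb J z))"
    using someI_ex[of "\<lambda>J'. J' \<in> imag_units \<and> emb J z = emb J' (sphere_label (emb J z))"]
      emb_sphere_label_ex[of "emb J z"] unfolding I_def by blast+
  have val: "unstem F (emb J z) = slice_eval I (F (sphere_label (emb J z)))"
    by (simp add: unstem_def I_def)
  have label: "sphere_label (emb J z) = Complex (Re z) \<bar>Im z\<bar>"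
    by (rule sphere_label_emb[OF J])
  have coords: "Im1 J * Im z = Im1 I * \<bar>Im z\<bar>" "Im2 J * Im z = Im2 I * \<bar>Im z\<bar>"
    "Im3 J * Im z = Im3 I * \<bar>Im z\<bar>" "Req I = 0" "Req J = 0"
    using arg_cong[OF I(2), of Im1] arg_cong[OF I(2), of Im2] arg_cong[OF I(2), of Im3] I(1) J
    by (simp_all add: emb_coords label imag_units_iff)
  consider "Im z > 0" | "Im z < 0" | "Im z = 0"
    by linarith
  then show ?thesis
  proof cases
    case 1
    then have "I = J" "sphere_label (emb J z) = z"
      using coords by (simp_all add: quat_eq_iff label complex_eq_iff)
    then show ?thesis
      by (simp add: val)
  next
    case 2
    then have "Im1 J = - Im1 I" "Im2 J = - Im2 I" "Im3 J = - Im3 I"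
      using coords(1-3) mult_right_cancel[of "Im z" "Im1 J" "- Im1 I"]
        mult_right_cancel[of "Im z" "Im2 J" "- Im2 I"] mult_right_cancel[of "Im z" "Im3 J" "- Im3 I"]
      by simp_all
    with 2 have "I = - J" "sphere_label (emb J z) = cnj z"
      using coords by (simp_all add: quat_eq_iff label complex_eq_iff uminus_quat_def)
    then show ?thesis
      by (simp add: val sym slice_eval_cnj)
  next
    case 3
    then have z: "cnj z = z" "sphere_label (emb J z) = z"
      by (simp_all add: label complex_eq_iff)
    have "qtn_Im (F z) = 0"
      using sym[of z] unfolding z by (auto simp: qtn_Im_def qtn_eq_iff qtn.map_sel complex_eq_iff quat_simps)
    then show ?thesis
      by (simp add: val z slice_eval_def)
  qed
qed

lemma stem_unstem: "compwise symmetric F \<Longrightarrow> stem (unstem F) z = F z"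
  by (rule stem_eqI) (simp_all add: unstem_emb quat_i_imag_unit uminus_imag_unit)

lemma sliced_on_unstem: "compwise symmetric F \<Longrightarrow> sliced_on D (unstem F)"
  by (simp add: sliced_on_def unstem_emb stem_unstem)

lemma comp_qtn_of_mult:
  "c \<in> {comp0, comp1, comp2, comp3} \<Longrightarrow> c (qtn_of a * b) = a * c b"
  by (auto simp: qtn_ring_defs qtn_of_def)

locale circular_domain =
  fixes \<Omega> :: "quat set" and z0 :: complex
  assumes open_domain: "open \<Omega>" and connected_domain: "connected \<Omega>"
    and circular_domain: "circular \<Omega>" and base_point: "z0 \<in> shadow \<Omega>"
begin

abbreviation U :: "complex set" where "U \<equiv> shadow \<Omega>"

lemma open_U: "open U"
  by (rule open_shadow[OF open_domain])

text \<open>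
  The domains on which representatives of semi-regular classes are regular: they omit only a
  discrete set of spheres and real points. In the plane this is a condition on punctured
  neighbourhoods, which makes finite intersections immediate.
\<close>

definition ample :: "quat set \<Rightarrow> bool" where
  "ample D \<longleftrightarrow> D \<subseteq> \<Omega> \<and> open D \<and> circular D \<and> (\<forall>z\<in>U. eventually (\<lambda>w. w \<in> shadow D) (at z))"

lemma ample_Int: "ample D \<Longrightarrow> ample E \<Longrightarrow> ample (D \<inter> E)"
  unfolding ample_def by (auto simp: circular_Int shadow_Int open_Int intro: eventually_conj)

lemma sem_domain_exceptional:
  assumes "sem_domain \<Omega> f D" "p \<in> \<Omega> - D"
  obtains V g m where "p \<in> V" "V \<subseteq> \<Omega>" "open V" "circular V" "V - sphere_of p \<subseteq> D"
    "slice_regular_on V g" "\<forall>q\<in>V - sphere_of p. g q = Delta p q ^ m * f q"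
proof -
  have "\<forall>p\<in>\<Omega> - D. \<exists>V g m. p \<in> V \<and> V \<subseteq> \<Omega> \<and> open V \<and> circular V \<and> V - sphere_of p \<subseteq> D \<and>
      slice_regular_on V g \<and> (\<forall>q\<in>V - sphere_of p. g q = Delta p q ^ m * f q)"
    using assms(1) unfolding sem_domain_def by (elim conjE)
  from bspec[OF this assms(2)] show thesis
    by (elim exE conjE) (rule that)
qed

lemma sem_domain_imp_ample:
  assumes "sem_domain \<Omega> f D"
  shows "ample D"
  unfolding ample_def
proof (intro conjI ballI)
  show "D \<subseteq> \<Omega>" "open D" "circular D"
    using assms by (simp_all add: sem_domain_def)
  fix z assume z: "z \<in> U"
  show "eventually (\<lambda>w. w \<in> shadow D) (at z)"
  proof (cases "z \<in> shadow D")
    case True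
    then show ?thesis
      using \<open>open D\<close> by (intro eventually_at_in_open' open_shadow)
  next
    case False
    let ?p = "emb quat_i z"
    have "?p \<in> \<Omega> - D"
      using z False by (simp add: shadow_def)
    then obtain V where V: "?p \<in> V" "open V" "circular V" "V - sphere_of ?p \<subseteq> D"
      by (rule sem_domain_exceptional[OF assms])
    have "eventually (\<lambda>w. w \<in> shadow V) (at z)"
      using V(1,2) by (intro eventually_at_in_open' open_shadow) (simp_all add: shadow_def)
    then show ?thesis
      using eventually_neq_at_within[of z z] eventually_neq_at_within[of "cnj z" z]
    proof eventually_elim
      case (elim w)
      then have "sphere_label (emb quat_i w) \<noteq> sphere_label ?p"
        by (auto simp: sphere_label_emb[OF quat_i_imag_unit] complex_eq_iff abs_eq_iff)
      with elim(1) V(4) show ?case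
        by (auto simp: shadow_def sphere_of_eq)
    qed
  qed
qed

text \<open>
  At a pole, multiplying \<open>f\<close> by \<open>\<Delta>\<^sub>p\<^sup>m\<close> multiplies the stem function by the complex
  polynomial \<open>((w - z) (w - cnj z))\<^sup>m\<close>; dividing by it shows that the stem function of \<open>f\<close>
  is meromorphic.
\<close>

lemma sem_domain_imp_meromorphic:
  assumes "sem_domain \<Omega> f D"
  shows "compwise (\<lambda>h. h meromorphic_on U) (stem f)"
proof -
  have D: "open D" "circular D" "slice_regular_on D f"
    using assms by (simp_all add: sem_domain_def)
  have "(\<lambda>w. c (stem f w)) meromorphic_on {z}" if z: "z \<in> U" and c: "c \<in> {comp0, comp1, comp2, comp3}" for z c
  proof (cases "z \<in> shadow D")
    case True
    have "(\<lambda>w. c (stem f w)) holomorphic_on shadow D"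
      using slice_regular_imp_holomorphic_stem(2)[OF D] c by (auto simp: compwise_iff)
    then have "(\<lambda>w. c (stem f w)) analytic_on {z}"
      using True open_shadow[OF D(1)] analytic_at by blast
    then show ?thesis
      by (rule analytic_on_imp_meromorphic_on)
  next
    case False
    let ?p = "emb quat_i z"
    have "?p \<in> \<Omega> - D"
      using z False by (simp add: shadow_def)
    then obtain V g m where V: "?p \<in> V" "open V" "circular V" "slice_regular_on V g"
      and g: "\<forall>q\<in>V - sphere_of ?p. g q = Delta ?p q ^ m * f q"
      by (rule sem_domain_exceptional[OF assms])
    define y where "y = sphere_label ?p"
    have y: "y = z \<or> y = cnj z"
      using sphere_label_emb_cases[OF quat_i_imag_unit, of z] unfolding y_def by metis
    define d where "d w = ((w - y) * (w - cnj y)) ^ m" for w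
    have "eventually (\<lambda>w. w \<in> shadow V) (at z)"
      using V(1,2) by (intro eventually_at_in_open' open_shadow) (simp_all add: shadow_def)
    then have ev: "eventually (\<lambda>w. c (stem f w) = c (stem g w) / d w) (at z)"
      using eventually_neq_at_within[of z z] eventually_neq_at_within[of "cnj z" z]
    proof eventually_elim
      case (elim w)
      have nz: "d w \<noteq> 0"
        using elim y by (auto simp: d_def)
      have *: "g (emb I w) = slice_eval I (qtn_of (d w) * stem f w)"
        if I: "I \<in> imag_units" and fI: "f (emb I w) = slice_eval I (stem f w)" for I
      proof -
        have "sphere_label (emb I w) \<noteq> sphere_label ?p"
          using elim by (auto simp: sphere_label_emb I quat_i_imag_unit complex_eq_iff abs_eq_iff)
        moreover have "emb I w \<in> V"
          using elim(1) by (simp add: emb_in_circular_iff V I)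
        ultimately have "g (emb I w) = Delta ?p (emb I w) ^ m * f (emb I w)"
          using g by (simp add: sphere_of_eq)
        then show ?thesis
          by (simp add: Delta_emb[OF I] slice_eval_scale[OF I] fI d_def emb_power[OF I] y_def)
      qed
      have "stem g w = qtn_of (d w) * stem f w"
        by (intro stem_eqI * quat_i_imag_unit uminus_imag_unit slice_eval_stem[symmetric])
      then show ?case
        using nz by (simp add: comp_qtn_of_mult[OF c])
    qed
    have "(\<lambda>w. c (stem g w)) holomorphic_on shadow V"
      using slice_regular_imp_holomorphic_stem(2)[OF V(2-4)] c by (auto simp: compwise_iff)
    then have "(\<lambda>w. c (stem g w)) analytic_on {z}"
      using V(1) open_shadow[OF V(2)] analytic_at by (auto simp: shadow_def)
    then have "(\<lambda>w. c (stem g w) / d w) meromorphic_on {z}"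
      unfolding d_def by (intro meromorphic_intros analytic_on_imp_meromorphic_on) auto
    then show ?thesis
      using meromorphic_on_cong[of "{z}", OF _ refl] ev by auto
  qed
  then show ?thesis
    unfolding compwise_iff by (metis meromorphic_on_meromorphic_at)
qed

text \<open>
  Conversely, at a point outside \<open>D\<close> a high power of \<open>\<Delta>\<^sub>p\<close> makes all four components of
  the stem function bounded near \<open>z\<close> and, by symmetry, near \<open>cnj z\<close>; after removing the
  singularities they are the stem function of the required regular extension.
\<close>

lemma sem_domain_extension:
  assumes D: "ample D" and f: "sliced_on D f"
    and hol: "compwise (\<lambda>h. h holomorphic_on shadow D) (stem f)"
    and mero: "compwise (\<lambda>h. h meromorphic_on U) (stem f)"
    and p: "p \<in> \<Omega> - D"
  shows "\<exists>V g m. p \<in> V \<and> V \<subseteq> \<Omega> \<and> open V \<and> circular V \<and> V - sphere_of p \<subseteq> D \<and>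
        slice_regular_on V g \<and> (\<forall>q\<in>V - sphere_of p. g q = Delta p q ^ m * f q)"
proof -
  let ?C = "{comp0, comp1, comp2, comp3} :: (complex qtn \<Rightarrow> complex) set"
  have Dp: "D \<subseteq> \<Omega>" "open D" "circular D"
    using D by (simp_all add: ample_def)
  define z where "z = sphere_label p"
  have zU: "z \<in> U"
    using p by (simp add: z_def sphere_label_in_shadow_iff circular_domain)
  have ev: "eventually (\<lambda>w. w \<in> shadow D) (at z)"
    using D zU by (simp add: ample_def)
  \<comment> \<open>A disc that meets the complement of \<open>D\<close> at most in \<open>z\<close>; the spheres over it form \<open>V\<close>.\<close>
  obtain r where r: "r > 0" "ball z r \<subseteq> U" "\<And>w. w \<in> ball z r \<Longrightarrow> w \<noteq> z \<Longrightarrow> w \<in> shadow D"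
  proof -
    obtain S where S: "open S" "z \<in> S" "\<And>w. w \<in> S \<Longrightarrow> w \<noteq> z \<Longrightarrow> w \<in> shadow D"
      using ev unfolding eventually_at_topological by blast
    have "open (S \<inter> U)" "z \<in> S \<inter> U"
      using open_U zU S by auto
    then obtain r where r: "r > 0" "ball z r \<subseteq> S \<inter> U"
      using openE by blast
    show ?thesis
      by (rule that[of r]) (use r S(3) in auto)
  qed
  define V where "V = {q. sphere_label q \<in> ball z r}"
  have V: "p \<in> V" "V \<subseteq> \<Omega>" "open V" "circular V" "V - sphere_of p \<subseteq> D"
  proof -
    show "p \<in> V"
      using r by (simp add: V_def z_def)
    show "V \<subseteq> \<Omega>"
      using r(2) sphere_label_in_shadow_iff[OF circular_domain] by (auto simp: V_def)
    show "open V"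
      unfolding V_def by (rule open_sphere_label_vimage) simp
    show "circular V"
      by (auto simp: V_def circular_iff)
    show "V - sphere_of p \<subseteq> D"
      using r(3) sphere_label_in_shadow_iff[OF Dp(3)] by (auto simp: V_def sphere_of_eq z_def)
  qed
  have "\<exists>n. \<forall>m\<ge>n. \<exists>L. (\<lambda>w. (w - z) ^ m * c (stem f w)) \<midarrow>z\<rightarrow> L" if "c \<in> ?C" for c
    using mero that zU by (intro meromorphic_times_power_tendsto)
      (auto simp: compwise_iff intro: meromorphic_on_subset)
  then obtain N where N: "\<And>c m. c \<in> ?C \<Longrightarrow> m \<ge> N c \<Longrightarrow> \<exists>L. (\<lambda>w. (w - z) ^ m * c (stem f w)) \<midarrow>z\<rightarrow> L"
    by metis
  \<comment> \<open>One exponent that serves all four components.\<close>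
  define m where "m = Max (N ` ?C)"
  define d where "d w = ((w - z) * (w - cnj z)) ^ m" for w
  define k where "k c w = d w * c (stem f w)" for c :: "complex qtn \<Rightarrow> complex" and w
  have k_lim: "\<exists>L. k c \<midarrow>z\<rightarrow> L" if c: "c \<in> ?C" for c
  proof -
    have "m \<ge> N c"
      using c unfolding m_def by (intro Max_ge) auto
    then obtain L where "(\<lambda>w. (w - z) ^ m * c (stem f w)) \<midarrow>z\<rightarrow> L"
      using N[OF c] by blast
    then have "(\<lambda>w. (w - cnj z) ^ m * ((w - z) ^ m * c (stem f w))) \<midarrow>z\<rightarrow> (z - cnj z) ^ m * L"
      by (intro tendsto_intros)
    moreover have "(\<lambda>w. (w - cnj z) ^ m * ((w - z) ^ m * c (stem f w))) = k c"
      by (auto simp: k_def d_def power_mult_distrib)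
    ultimately show ?thesis
      by auto
  qed
  have k_sym: "symmetric (k c)" if "c \<in> ?C" for c
    using stem_comp_symmetric[OF that, of f]
    by (auto simp: symmetric_def k_def d_def power_mult_distrib)
  have k_mero: "k c meromorphic_on U" if "c \<in> ?C" for c
    using mero that unfolding k_def d_def compwise_iff by (intro meromorphic_intros) auto
  have k_analytic: "k c analytic_on {w}" if "c \<in> ?C" "w \<in> shadow D" for c w
  proof -
    have "(\<lambda>w. c (stem f w)) analytic_on {w}"
      using hol that open_shadow[OF Dp(2)] unfolding compwise_iff analytic_at by blast
    then show ?thesis
      unfolding k_def d_def by (intro analytic_intros)
  qed
  have hol_k: "remove_sings (k c) holomorphic_on shadow V" if c: "c \<in> ?C" for c
  proof -
    have "remove_sings (k c) analytic_on {w}" if w: "w \<in> shadow V" for w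
    proof -
      have wU: "w \<in> U"
        using w shadow_mono[OF V(2)] by blast
      have "\<exists>L. k c \<midarrow>w\<rightarrow> L"
      proof (cases "w = z \<or> w = cnj z")
        case True
        then show ?thesis
          using k_lim[OF c] tendsto_symmetric[OF k_sym[OF c]] by blast
      next
        case False
        \<comment> \<open>\<open>w\<close> may lie in the reflected disc, so the disc is reached through the label of its sphere.\<close>
        let ?y = "sphere_label (emb quat_i w)"
        have "?y = w \<or> ?y = cnj w"
          using sphere_label_emb_cases[OF quat_i_imag_unit, of w] by metis
        with False have "?y \<noteq> z"
          by auto
        moreover have "?y \<in> ball z r"
          using w by (simp add: V_def shadow_def)
        ultimately have "?y \<in> shadow D"
          using r(3) by blast
        then have "w \<in> shadow D"
          by (simp add: sphere_label_in_shadow_iff[OF Dp(3)]) (simp add: shadow_def)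
        then show ?thesis
          using analytic_at_imp_isCont[OF k_analytic[OF c]] isContD by blast
      qed
      then show ?thesis
        using remove_sings_analytic_at meromorphic_on_isolated_singularity
          meromorphic_on_subset[OF k_mero[OF c]] wU by blast
    qed
    then have "remove_sings (k c) analytic_on shadow V"
      using analytic_on_analytic_at by blast
    then show ?thesis
      by (rule analytic_imp_holomorphic)
  qed
  define H where "H w = Qtn (remove_sings (k comp0) w) (remove_sings (k comp1) w)
      (remove_sings (k comp2) w) (remove_sings (k comp3) w)" for w
  have H_sym: "compwise symmetric H"
    unfolding compwise_def H_def qtn.sel using symmetric_remove_sings[OF k_sym] by simp
  have "slice_regular_on V (unstem H)"
  proof (rule holomorphic_stem_imp_slice_regular[OF V(3,4) sliced_on_unstem[OF H_sym]])
    show "compwise (\<lambda>h. h holomorphic_on shadow V) (stem (unstem H))"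
      unfolding stem_unstem[OF H_sym] using hol_k by (simp add: compwise_def H_def)
  qed
  moreover have "unstem H q = Delta p q ^ m * f q" if q: "q \<in> V - sphere_of p" for q
  proof -
    define w where "w = sphere_label q"
    obtain J where J: "J \<in> imag_units" "q = emb J w"
      using emb_sphere_label_ex[of q] by (auto simp: w_def)
    have w: "w \<in> shadow D"
      using q V(5) sphere_label_in_shadow_iff[OF Dp(3)] by (auto simp: w_def)
    have "H w = qtn_of (d w) * stem f w"
      using remove_sings_at_analytic[OF k_analytic[OF _ w]]
      by (simp add: H_def qtn_eq_iff comp_qtn_of_mult k_def)
    then have "unstem H q = emb J (d w) * f q"
      using f J w by (simp add: unstem_emb[OF H_sym] slice_eval_scale sliced_on_def)
    then show ?thesis
      using J by (simp add: Delta_emb emb_power d_def z_def)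
  qed
  ultimately show ?thesis
    using V by blast
qed

text \<open>
  The dictionary between quaternionic and complex analysis: after this equivalence the spherical
  poles and the functions that resolve them no longer appear.
\<close>

lemma sem_domain_iff:
  "sem_domain \<Omega> f D \<longleftrightarrow> ample D \<and> sliced_on D f \<and>
     compwise (\<lambda>h. h holomorphic_on shadow D) (stem f) \<and> compwise (\<lambda>h. h meromorphic_on U) (stem f)"
proof
  assume f: "sem_domain \<Omega> f D"
  then have "open D" "circular D" "slice_regular_on D f"
    by (simp_all add: sem_domain_def)
  with f show "ample D \<and> sliced_on D f \<and>
     compwise (\<lambda>h. h holomorphic_on shadow D) (stem f) \<and> compwise (\<lambda>h. h meromorphic_on U) (stem f)"
    using slice_regular_imp_holomorphic_stem sem_domain_imp_ample sem_domain_imp_meromorphic by blast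
next
  assume *: "ample D \<and> sliced_on D f \<and>
     compwise (\<lambda>h. h holomorphic_on shadow D) (stem f) \<and> compwise (\<lambda>h. h meromorphic_on U) (stem f)"
  then have "D \<subseteq> \<Omega>" "open D" "circular D"
    by (simp_all add: ample_def)
  moreover from this * have "slice_regular_on D f"
    by (intro holomorphic_stem_imp_slice_regular) simp_all
  ultimately show "sem_domain \<Omega> f D"
    unfolding sem_domain_def using * by (intro conjI ballI sem_domain_extension) simp_all
qed

end

section \<open>Laurent expansions at the base point\<close>

context circular_domain
begin

text \<open>
  The identity theorem. The set \<open>shadow \<Omega>\<close> itself may consist of two conjugate components, so
  connectedness is used on \<open>\<Omega>\<close>: the points whose sphere label has a neighbourhood where
  \<open>h\<close> vanishes form an open and closed subset of \<open>\<Omega>\<close>.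
\<close>

lemma meromorphic_identity:
  assumes h: "h meromorphic_on U" "symmetric h" and 0: "laurent_expansion h z0 = 0"
    and z: "z \<in> U"
  shows "eventually (\<lambda>w. h w = 0) (at z)"
proof -
  define W where "W = {w \<in> U. eventually (\<lambda>v. h v = 0) (at w)}"
  define W' where "W' = {w \<in> U. eventually (\<lambda>v. h v \<noteq> 0) (at w)}"
  have expansion: "(\<lambda>w. h (y + w)) has_laurent_expansion laurent_expansion h y" if "y \<in> U" for y
    using h(1) that by (rule meromorphic_on_imp_has_laurent_expansion)
  have nonzero_iff: "eventually (\<lambda>v. h v \<noteq> 0) (at y) \<longleftrightarrow> laurent_expansion h y \<noteq> 0" if "y \<in> U" for y
    using expansion[OF that] by (rule has_laurent_expansion_eventually_nonzero_iff)
  have zero_iff: "eventually (\<lambda>v. h v = 0) (at y) \<longleftrightarrow> laurent_expansion h y = 0" if "y \<in> U" for y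
  proof
    assume "eventually (\<lambda>v. h v = 0) (at y)"
    then show "laurent_expansion h y = 0"
      by (simp add: laurent_expansion_def)
  next
    assume "laurent_expansion h y = 0"
    then have "eventually (\<lambda>w. 0 = h (y + w)) (at 0)"
      using expansion[OF that] by (simp add: has_laurent_expansion_def)
    then show "eventually (\<lambda>v. h v = 0) (at y)"
      by (simp add: at_to_0[of y] eventually_filtermap add.commute eq_commute[of 0])
  qed
  have open_set: "open {w \<in> U. eventually P (at w)}" for P
  proof (subst open_subopen, intro ballI)
    fix w assume "w \<in> {w \<in> U. eventually P (at w)}"
    then obtain S where "open S" "w \<in> S" "\<And>v. v \<in> S \<Longrightarrow> eventually P (at v)" "w \<in> U"
      using eventually_at_imp_open by blast
    then show "\<exists>T. open T \<and> w \<in> T \<and> T \<subseteq> {w \<in> U. eventually P (at w)}"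
      using open_U by (intro exI[of _ "S \<inter> U"]) auto
  qed
  define A where "A = {q. sphere_label q \<in> W}"
  define A' where "A' = {q. sphere_label q \<in> W'}"
  have "open A" "open A'"
    unfolding A_def A'_def W_def W'_def by (intro open_sphere_label_vimage open_set)+
  moreover have "\<Omega> \<subseteq> A \<union> A'"
    using zero_iff nonzero_iff sphere_label_in_shadow_iff[OF circular_domain]
    by (auto simp: A_def A'_def W_def W'_def)
  moreover have "A \<inter> A' \<inter> \<Omega> = {}"
    using zero_iff nonzero_iff by (auto simp: A_def A'_def W_def W'_def)
  ultimately have "A \<inter> \<Omega> = {} \<or> A' \<inter> \<Omega> = {}"
    by (intro connectedD[OF connected_domain]) auto
  have W_sym: "cnj y \<in> W" if "y \<in> W" for y
    using that eventually_symmetric[OF h(2)] shadow_cnj_iff[OF circular_domain] by (auto simp: W_def)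
  have in_A_iff: "emb quat_i y \<in> A \<longleftrightarrow> y \<in> W" for y
    using W_sym[of y] W_sym[of "cnj y"] sphere_label_emb_cases[OF quat_i_imag_unit, of y]
    unfolding A_def by (metis complex_cnj_cnj mem_Collect_eq)
  have "z0 \<in> W"
    using 0 base_point zero_iff by (simp add: W_def)
  then have "emb quat_i z0 \<in> A \<inter> \<Omega>"
    using in_A_iff base_point by (simp add: shadow_def)
  with \<open>A \<inter> \<Omega> = {} \<or> A' \<inter> \<Omega> = {}\<close> \<open>\<Omega> \<subseteq> A \<union> A'\<close> have "\<Omega> \<subseteq> A"
    by blast
  then have "z \<in> W"
    using z in_A_iff by (auto simp: shadow_def)
  then show ?thesis
    by (simp add: W_def)
qed

lemma laurent_expansion_operations:
  assumes "h meromorphic_on U" "k meromorphic_on U"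
  shows "laurent_expansion (\<lambda>z. h z + k z) z0 = laurent_expansion h z0 + laurent_expansion k z0"
    "laurent_expansion (\<lambda>z. h z - k z) z0 = laurent_expansion h z0 - laurent_expansion k z0"
    "laurent_expansion (\<lambda>z. h z * k z) z0 = laurent_expansion h z0 * laurent_expansion k z0"
    "laurent_expansion (\<lambda>z. - h z) z0 = - laurent_expansion h z0"
    "laurent_expansion (\<lambda>z. inverse (h z)) z0 = inverse (laurent_expansion h z0)"
  using assms[THEN meromorphic_on_imp_has_laurent_expansion[OF _ base_point]]
  by (auto intro!: laurent_expansion_eqI laurent_expansion_intros)

lemma laurent_expansion_eq_iff:
  assumes "h meromorphic_on U" "symmetric h" "k meromorphic_on U" "symmetric k"
  shows "laurent_expansion h z0 = laurent_expansion k z0 \<longleftrightarrow>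
    (\<forall>z\<in>U. eventually (\<lambda>w. h w = k w) (at z))"
proof
  assume "laurent_expansion h z0 = laurent_expansion k z0"
  then have "laurent_expansion (\<lambda>z. h z - k z) z0 = 0"
    using assms by (simp add: laurent_expansion_operations)
  then show "\<forall>z\<in>U. eventually (\<lambda>w. h w = k w) (at z)"
    using meromorphic_identity[of "\<lambda>z. h z - k z"] assms
    by (auto simp: symmetric_def intro!: meromorphic_intros)
next
  assume "\<forall>z\<in>U. eventually (\<lambda>w. h w = k w) (at z)"
  then show "laurent_expansion h z0 = laurent_expansion k z0"
    using base_point by (intro laurent_expansion_cong) auto
qed

text \<open>
  Expanding at one point turns the symmetric meromorphic functions on \<open>shadow \<Omega>\<close>, considered up to isolated
  points, into a subset of an honest field, where inverses of nonzero elements are at hand.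
\<close>

definition scalar_field :: "complex fls set" where
  "scalar_field = {laurent_expansion h z0 | h. h meromorphic_on U \<and> symmetric h}"

lemma scalar_fieldI:
  "h meromorphic_on U \<Longrightarrow> symmetric h \<Longrightarrow> laurent_expansion h z0 \<in> scalar_field"
  by (auto simp: scalar_field_def)

sublocale coefficient_field scalar_field
proof
  have "laurent_expansion (\<lambda>_. 1) z0 = 1"
    by (intro laurent_expansion_eqI) simp
  then show "1 \<in> scalar_field"
    using scalar_fieldI[of "\<lambda>_. 1"] by (simp add: symmetric_def meromorphic_on_const)
next
  fix a b assume "a \<in> scalar_field"
  then obtain h where h: "a = laurent_expansion h z0" "h meromorphic_on U" "symmetric h"
    by (auto simp: scalar_field_def)
  have "laurent_expansion (\<lambda>z. - h z) z0 \<in> scalar_field"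
    using h by (intro scalar_fieldI meromorphic_intros) (auto simp: symmetric_def)
  then show "- a \<in> scalar_field"
    using h laurent_expansion_operations(4) by simp
  have "laurent_expansion (\<lambda>z. inverse (h z)) z0 \<in> scalar_field"
    using h by (intro scalar_fieldI meromorphic_intros) (auto simp: symmetric_def)
  then show "inverse a \<in> scalar_field"
    using h laurent_expansion_operations(5) by simp
  assume "b \<in> scalar_field"
  then obtain k where k: "b = laurent_expansion k z0" "k meromorphic_on U" "symmetric k"
    by (auto simp: scalar_field_def)
  have "laurent_expansion (\<lambda>z. h z + k z) z0 \<in> scalar_field"
    using h k by (intro scalar_fieldI meromorphic_intros) (auto simp: symmetric_def)
  then show "a + b \<in> scalar_field"
    using h k laurent_expansion_operations(1) by simp
  have "laurent_expansion (\<lambda>z. h z * k z) z0 \<in> scalar_field"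
    using h k by (intro scalar_fieldI meromorphic_intros) (auto simp: symmetric_def)
  then show "a * b \<in> scalar_field"
    using h k laurent_expansion_operations(3) by simp
qed

definition qtn_laurent :: "(complex \<Rightarrow> complex qtn) \<Rightarrow> complex fls qtn" where
  "qtn_laurent F = Qtn (laurent_expansion (\<lambda>z. comp0 (F z)) z0) (laurent_expansion (\<lambda>z. comp1 (F z)) z0)
     (laurent_expansion (\<lambda>z. comp2 (F z)) z0) (laurent_expansion (\<lambda>z. comp3 (F z)) z0)"

lemma qtn_laurent_operations:
  assumes F: "compwise (\<lambda>h. h meromorphic_on U) F" and G: "compwise (\<lambda>h. h meromorphic_on U) G"
  shows "compwise (\<lambda>h. h meromorphic_on U) (\<lambda>z. F z + G z)"
    "compwise (\<lambda>h. h meromorphic_on U) (\<lambda>z. F z * G z)"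
    "qtn_laurent (\<lambda>z. F z + G z) = qtn_laurent F + qtn_laurent G"
    "qtn_laurent (\<lambda>z. F z * G z) = qtn_laurent F * qtn_laurent G"
proof -
  note mero = F[unfolded compwise_def] G[unfolded compwise_def]
  show "compwise (\<lambda>h. h meromorphic_on U) (\<lambda>z. F z + G z)"
    "compwise (\<lambda>h. h meromorphic_on U) (\<lambda>z. F z * G z)"
    using mero unfolding compwise_def
    by (auto simp: qtn_ring_defs intro!: meromorphic_intros)
  show "qtn_laurent (\<lambda>z. F z + G z) = qtn_laurent F + qtn_laurent G"
    "qtn_laurent (\<lambda>z. F z * G z) = qtn_laurent F * qtn_laurent G"
    using mero
    by (simp_all add: qtn_laurent_def qtn_ring_defs laurent_expansion_operations meromorphic_intros)
qed

lemma qtn_laurent_cong: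
  assumes "eventually (\<lambda>w. F w = G w) (at z0)"
  shows "qtn_laurent F = qtn_laurent G"
proof -
  have "laurent_expansion (\<lambda>w. c (F w)) z0 = laurent_expansion (\<lambda>w. c (G w)) z0" for c :: "complex qtn \<Rightarrow> complex"
    using assms by (intro laurent_expansion_cong refl) (auto elim: eventually_mono)
  then show ?thesis
    by (simp add: qtn_laurent_def)
qed

end

section \<open>Semi-regular functions as quaternions over the scalar field\<close>

context circular_domain
begin

definition semi_regular :: "(quat \<Rightarrow> quat) set" where
  "semi_regular = {f. \<exists>D. sem_domain \<Omega> f D}"

definition expansion :: "(quat \<Rightarrow> quat) \<Rightarrow> complex fls qtn" where
  "expansion f = qtn_laurent (stem f)"

lemma semi_regular_meromorphic:
  "f \<in> semi_regular \<Longrightarrow> compwise (\<lambda>h. h meromorphic_on U) (stem f)"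
  by (auto simp: semi_regular_def sem_domain_iff)

lemma expansion_mem: "f \<in> semi_regular \<Longrightarrow> expansion f \<in> quaternions"
  using semi_regular_meromorphic[of f] stem_comp_symmetric[of _ f]
  by (auto simp: expansion_def qtn_laurent_def Qtn_mem_iff compwise_def intro!: scalar_fieldI)

text \<open>
  The common source of semi-regularity for sums, star products, constants and prescribed stem
  functions. A stem function is determined by the values on one slice, so it coincides with \<open>F\<close> on the shadow
  of \<open>D\<close>, that is, near every point of \<open>shadow \<Omega>\<close> except possibly at the point itself.
\<close>

lemma semi_regularI:
  assumes D: "ample D" and F: "compwise (\<lambda>h. h holomorphic_on shadow D) F"
      "compwise (\<lambda>h. h meromorphic_on U) F"
    and f: "\<And>J z. J \<in> imag_units \<Longrightarrow> z \<in> shadow D \<Longrightarrow> f (emb J z) = slice_eval J (F z)"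
  shows "sem_domain \<Omega> f D" "expansion f = qtn_laurent F"
proof -
  have stem: "stem f z = F z" if "z \<in> shadow D" for z
    using f that by (intro stem_eqI) (simp_all add: quat_i_imag_unit uminus_imag_unit)
  have ev: "eventually (\<lambda>w. stem f w = F w) (at z)" if "z \<in> U" for z
  proof -
    have "eventually (\<lambda>w. w \<in> shadow D) (at z)"
      using D that by (simp add: ample_def)
    then show ?thesis
      by eventually_elim (rule stem)
  qed
  have "(\<lambda>w. c (stem f w)) meromorphic_on U" if "(\<lambda>w. c (F w)) meromorphic_on U" for c
  proof (subst meromorphic_on_cong[OF _ refl])
    fix z assume "z \<in> U"
    then show "eventually (\<lambda>w. c (stem f w) = c (F w)) (at z)"
      by (intro eventually_mono[OF ev]) simp_all
  qed (rule that)
  then have "compwise (\<lambda>h. h meromorphic_on U) (stem f)"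
    using F(2) by (simp add: compwise_def)
  moreover have "(\<lambda>w. c (stem f w)) holomorphic_on shadow D"
    if "(\<lambda>w. c (F w)) holomorphic_on shadow D" for c
    using that by (rule holomorphic_transform) (simp add: stem)
  then have "compwise (\<lambda>h. h holomorphic_on shadow D) (stem f)"
    using F(1) by (simp add: compwise_def)
  moreover have "sliced_on D f"
    using f stem by (simp add: sliced_on_def)
  ultimately show "sem_domain \<Omega> f D"
    using D by (simp add: sem_domain_iff)
  show "expansion f = qtn_laurent F"
    unfolding expansion_def using ev[OF base_point] by (rule qtn_laurent_cong)
qed

lemma compwise_holomorphic_operations:
  assumes "compwise (\<lambda>h. h holomorphic_on A) F" "compwise (\<lambda>h. h holomorphic_on A) G"
  shows "compwise (\<lambda>h. h holomorphic_on A) (\<lambda>z. F z + G z)"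
    "compwise (\<lambda>h. h holomorphic_on A) (\<lambda>z. F z * G z)"
  using assms by (auto simp: compwise_def qtn_ring_defs intro!: holomorphic_intros)

lemma compwise_holomorphic_subset:
  "compwise (\<lambda>h. h holomorphic_on A) F \<Longrightarrow> B \<subseteq> A \<Longrightarrow> compwise (\<lambda>h. h holomorphic_on B) F"
  by (auto simp: compwise_def intro: holomorphic_on_subset)

lemma semi_regular_operations:
  assumes f: "f \<in> semi_regular" and g: "g \<in> semi_regular"
  shows "(\<lambda>q. f q + g q) \<in> semi_regular" "expansion (\<lambda>q. f q + g q) = expansion f + expansion g"
    "star f g \<in> semi_regular" "expansion (star f g) = expansion f * expansion g"
proof -
  obtain D E where f': "sem_domain \<Omega> f D" and g': "sem_domain \<Omega> g E"
    using f g by (auto simp: semi_regular_def)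
  have D: "ample (D \<inter> E)"
    using f' g' by (simp add: sem_domain_iff ample_Int)
  have hol: "compwise (\<lambda>h. h holomorphic_on shadow (D \<inter> E)) (stem f)"
    "compwise (\<lambda>h. h holomorphic_on shadow (D \<inter> E)) (stem g)"
    using f' g' by (auto simp: sem_domain_iff shadow_Int intro: compwise_holomorphic_subset)
  have mero: "compwise (\<lambda>h. h meromorphic_on U) (stem f)" "compwise (\<lambda>h. h meromorphic_on U) (stem g)"
    using f g by (simp_all add: semi_regular_meromorphic)
  have val: "f (emb J z) = slice_eval J (stem f z)" "g (emb J z) = slice_eval J (stem g z)"
    if "J \<in> imag_units" "z \<in> shadow (D \<inter> E)" for J z
    using f' g' that by (auto simp: sem_domain_iff sliced_on_def shadow_Int)
  note sum = semi_regularI[OF D compwise_holomorphic_operations(1)[OF hol]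
      qtn_laurent_operations(1)[OF mero], of "\<lambda>q. f q + g q"]
  show "(\<lambda>q. f q + g q) \<in> semi_regular" "expansion (\<lambda>q. f q + g q) = expansion f + expansion g"
    using sum val qtn_laurent_operations(3)[OF mero]
    by (auto simp: semi_regular_def slice_eval_add expansion_def)
  note prod = semi_regularI[OF D compwise_holomorphic_operations(2)[OF hol]
      qtn_laurent_operations(2)[OF mero], of "star f g", OF star_slice_eval]
  show "star f g \<in> semi_regular" "expansion (star f g) = expansion f * expansion g"
    using prod val qtn_laurent_operations(4)[OF mero]
    by (auto simp: semi_regular_def expansion_def)
qed

lemma ample_domain: "ample \<Omega>"
  unfolding ample_def using open_domain circular_domain open_U eventually_at_in_open' by blast

lemma const_semi_regular:
  fixes q :: quat
  shows "(\<lambda>_. q) \<in> semi_regular"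
    "expansion (\<lambda>_. q) = Qtn (fls_const (of_real (Req q))) (fls_const (of_real (Im1 q)))
       (fls_const (of_real (Im2 q))) (fls_const (of_real (Im3 q)))"
proof -
  let ?F = "\<lambda>_. Qtn (of_real (Req q)) (of_real (Im1 q)) (of_real (Im2 q)) (of_real (Im3 q)) :: complex qtn"
  have "compwise (\<lambda>h. h holomorphic_on shadow \<Omega>) ?F" "compwise (\<lambda>h. h meromorphic_on U) ?F"
    by (simp_all add: compwise_def meromorphic_on_const)
  moreover have "q = slice_eval J (Qtn (of_real (Req q)) (of_real (Im1 q)) (of_real (Im2 q)) (of_real (Im3 q)))" for J
    by (simp add: stem_simps quat_simps)
  ultimately have "sem_domain \<Omega> (\<lambda>_. q) \<Omega>" and eq: "expansion (\<lambda>_. q) = qtn_laurent ?F"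
    using semi_regularI[OF ample_domain, of ?F "\<lambda>_. q"] by blast+
  then show "(\<lambda>_. q) \<in> semi_regular"
    by (auto simp: semi_regular_def)
  from eq show "expansion (\<lambda>_. q) = Qtn (fls_const (of_real (Req q))) (fls_const (of_real (Im1 q)))
       (fls_const (of_real (Im2 q))) (fls_const (of_real (Im3 q)))"
    by (simp add: qtn_laurent_def laurent_expansion_eqI[OF has_laurent_expansion_const])
qed

text \<open>
  Agreement on the common domain of regularity gives agreement near the base point. Conversely equal
  expansions propagate to a punctured neighbourhood of every point by the identity theorem, and
  continuity fills in the points where both functions are regular. In particular the relation
  is an equivalence.
\<close>

lemma sem_rel_iff:
  "(f, g) \<in> sem_rel \<Omega> \<longleftrightarrow> f \<in> semi_regular \<and> g \<in> semi_regular \<and> expansion f = expansion g"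
proof
  assume "(f, g) \<in> sem_rel \<Omega>"
  then obtain D E where f: "sem_domain \<Omega> f D" and g: "sem_domain \<Omega> g E"
    and eq: "\<And>q. q \<in> D \<inter> E \<Longrightarrow> f q = g q"
    by (auto simp: sem_rel_def)
  have "ample (D \<inter> E)"
    using f g by (simp add: sem_domain_iff ample_Int)
  then have "circular (D \<inter> E)" "eventually (\<lambda>w. w \<in> shadow (D \<inter> E)) (at z0)"
    using base_point by (simp_all add: ample_def)
  have "stem f w = stem g w" if "w \<in> shadow (D \<inter> E)" for w
    using eq emb_in_circular_iff[OF \<open>circular (D \<inter> E)\<close>] that quat_i_imag_unit
      uminus_imag_unit[OF quat_i_imag_unit]
    by (intro stem_eqI) (metis slice_eval_stem)+
  with \<open>eventually (\<lambda>w. w \<in> shadow (D \<inter> E)) (at z0)\<close> have "expansion f = expansion g"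
    unfolding expansion_def by (intro qtn_laurent_cong) (auto elim: eventually_mono)
  with f g show "f \<in> semi_regular \<and> g \<in> semi_regular \<and> expansion f = expansion g"
    by (auto simp: semi_regular_def)
next
  assume *: "f \<in> semi_regular \<and> g \<in> semi_regular \<and> expansion f = expansion g"
  then obtain D E where f: "sem_domain \<Omega> f D" and g: "sem_domain \<Omega> g E"
    by (auto simp: semi_regular_def)
  have D: "circular D" "circular E" "open D" "open E" "D \<subseteq> \<Omega>"
    using f g by (simp_all add: sem_domain_iff ample_def)
  have "c (stem f z) = c (stem g z)"
    if z: "z \<in> shadow D" "z \<in> shadow E" and c: "c \<in> {comp0, comp1, comp2, comp3}" for z c
  proof -
    have "laurent_expansion (\<lambda>z. c (stem f z)) z0 = laurent_expansion (\<lambda>z. c (stem g z)) z0"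
      using * c by (auto simp: expansion_def qtn_laurent_def)
    moreover have "(\<lambda>z. c (stem f z)) meromorphic_on U" "(\<lambda>z. c (stem g z)) meromorphic_on U"
      using * c semi_regular_meromorphic by (auto simp: compwise_def)
    moreover have "z \<in> U"
      using z(1) shadow_mono[OF D(5)] by blast
    ultimately have ev: "eventually (\<lambda>w. c (stem f w) = c (stem g w)) (at z)"
      using laurent_expansion_eq_iff stem_comp_symmetric[OF c] by blast
    have "(\<lambda>z. c (stem f z)) holomorphic_on shadow D" "(\<lambda>z. c (stem g z)) holomorphic_on shadow E"
      using f g c by (auto simp: sem_domain_iff compwise_def)
    then have "isCont (\<lambda>z. c (stem f z)) z" "isCont (\<lambda>z. c (stem g z)) z"
      using z open_shadow[OF D(3)] open_shadow[OF D(4)] holomorphic_on_imp_continuous_on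
        continuous_on_eq_continuous_at by blast+
    then have "(\<lambda>z. c (stem f z)) \<midarrow>z\<rightarrow> c (stem f z)" "(\<lambda>z. c (stem g z)) \<midarrow>z\<rightarrow> c (stem g z)"
      by (simp_all add: isCont_def)
    then show ?thesis
      using tendsto_unique[OF at_neq_bot] tendsto_cong[OF ev] by blast
  qed
  then have stem: "stem f z = stem g z" if "z \<in> shadow D" "z \<in> shadow E" for z
    using that by (simp add: qtn_eq_iff)
  have "f q = g q" if q: "q \<in> D \<inter> E" for q
  proof -
    obtain J where J: "J \<in> imag_units" "q = emb J (sphere_label q)"
      using emb_sphere_label_ex by blast
    have "sphere_label q \<in> shadow D" "sphere_label q \<in> shadow E"
      using q D by (simp_all add: sphere_label_in_shadow_iff)
    with J f g stem show ?thesis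
      by (metis sem_domain_iff sliced_on_def)
  qed
  with f g show "(f, g) \<in> sem_rel \<Omega>"
    by (auto simp: sem_rel_def)
qed

text \<open>
  The points where all four components are analytic form the shadow of an ample set, because
  meromorphic functions have isolated singularities and symmetry makes the set invariant
  under conjugation.
\<close>

lemma unstem_semi_regular:
  assumes F: "compwise symmetric F" "compwise (\<lambda>h. h meromorphic_on U) F"
  shows "unstem F \<in> semi_regular" "expansion (unstem F) = qtn_laurent F"
proof -
  define A where "A = {z. compwise (\<lambda>h. h analytic_on {z}) F}"
  define D where "D = \<Omega> \<inter> {q. sphere_label q \<in> A}"
  have A_cnj: "cnj z \<in> A \<longleftrightarrow> z \<in> A" for z
    using F(1) analytic_symmetric[of _ z] analytic_symmetric[of _ "cnj z"]
    by (auto simp: A_def compwise_def)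
  have "open A"
  proof -
    have "open {z. h analytic_on {z}}" for h :: "complex \<Rightarrow> complex"
    proof (subst open_subopen, intro ballI)
      fix z assume "z \<in> {z. h analytic_on {z}}"
      then obtain S where "open S" "z \<in> S" "h holomorphic_on S"
        by (auto simp: analytic_at)
      then show "\<exists>T. open T \<and> z \<in> T \<and> T \<subseteq> {z. h analytic_on {z}}"
        by (intro exI[of _ S]) (auto simp: analytic_at)
    qed
    then show ?thesis
      unfolding A_def compwise_def Collect_conj_eq by (intro open_Int)
  qed
  have shadow_D: "shadow D = U \<inter> A"
  proof -
    have "sphere_label (emb quat_i z) \<in> A \<longleftrightarrow> z \<in> A" for z
      by (rule sphere_label_emb_cases[OF quat_i_imag_unit, of z]) (simp_all add: A_cnj)
    then show ?thesis
      by (auto simp: D_def shadow_def)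
  qed
  have "ample D"
    unfolding ample_def
  proof (intro conjI ballI)
    show "open D"
      unfolding D_def by (intro open_Int open_domain open_sphere_label_vimage \<open>open A\<close>)
    show "circular D"
      unfolding D_def by (intro circular_Int circular_domain) (auto simp: circular_iff)
    fix z assume z: "z \<in> U"
    have "eventually (\<lambda>w. h analytic_on {w}) (at z)" if "h meromorphic_on U" for h
    proof -
      have "isolated_singularity_at h z"
        using that z by (simp add: meromorphic_on_altdef)
      then obtain r where "r > 0" "h analytic_on ball z r - {z}"
        by (auto simp: isolated_singularity_at_def)
      then show ?thesis
        unfolding eventually_at_topological
        by (intro exI[of _ "ball z r"]) (auto intro: analytic_on_subset)
    qed
    then have "eventually (\<lambda>w. w \<in> A) (at z)"
      using F(2) unfolding A_def compwise_def mem_Collect_eq by (intro eventually_conj) auto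
    moreover have "eventually (\<lambda>w. w \<in> U) (at z)"
      using z open_U by (intro eventually_at_in_open')
    ultimately show "eventually (\<lambda>w. w \<in> shadow D) (at z)"
      by eventually_elim (simp add: shadow_D)
  qed (auto simp: D_def)
  moreover have "compwise (\<lambda>h. h holomorphic_on shadow D) F"
    unfolding compwise_def shadow_D A_def
    by (auto intro!: analytic_imp_holomorphic simp: analytic_on_analytic_at[of _ "_ \<inter> _"] compwise_def)
  ultimately have "sem_domain \<Omega> (unstem F) D" "expansion (unstem F) = qtn_laurent F"
    using semi_regularI F(2) unstem_emb[OF F(1)] by blast+
  then show "unstem F \<in> semi_regular" "expansion (unstem F) = qtn_laurent F"
    by (auto simp: semi_regular_def)
qed

text \<open>
  The component functions are chosen so that a vanishing coefficient is represented by the function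
  that is zero everywhere, not just off isolated points. For scalars this gives a function that preserves slices
  at every point.
\<close>

lemma expansion_surj:
  assumes "x \<in> quaternions"
  obtains F where "compwise symmetric F" "compwise (\<lambda>h. h meromorphic_on U) F"
    "x = qtn_laurent F" "\<And>z. x = qtn_of (comp0 x) \<Longrightarrow> F z = qtn_of (comp0 (F z))"
proof -
  have "\<exists>h. h meromorphic_on U \<and> symmetric h \<and> a = laurent_expansion h z0 \<and> (a = 0 \<longrightarrow> h = (\<lambda>_. 0))"
    if "a \<in> scalar_field" for a
  proof (cases "a = 0")
    case True
    have "laurent_expansion (\<lambda>_. 0) z0 = 0"
      by (intro laurent_expansion_eqI) simp
    with True show ?thesis
      by (intro exI[of _ "\<lambda>_. 0"]) (simp add: symmetric_def meromorphic_on_const)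
  next
    case False
    with that show ?thesis
      by (auto simp: scalar_field_def)
  qed
  then have "\<forall>a\<in>scalar_field. \<exists>h. h meromorphic_on U \<and> symmetric h \<and>
      a = laurent_expansion h z0 \<and> (a = 0 \<longrightarrow> h = (\<lambda>_. 0))"
    by blast
  from bchoice[OF this] obtain h where h: "\<And>a. a \<in> scalar_field \<Longrightarrow> h a meromorphic_on U"
    "\<And>a. a \<in> scalar_field \<Longrightarrow> symmetric (h a)"
    "\<And>a. a \<in> scalar_field \<Longrightarrow> a = laurent_expansion (h a) z0"
    "0 \<in> scalar_field \<Longrightarrow> h 0 = (\<lambda>_. 0)"
    by blast
  define F where "F z = Qtn (h (comp0 x) z) (h (comp1 x) z) (h (comp2 x) z) (h (comp3 x) z)" for z
  note x = assms[unfolded mem_quaternions_iff]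
  show ?thesis
  proof (rule that)
    show "compwise symmetric F" "compwise (\<lambda>h. h meromorphic_on U) F"
      using x h(1,2) by (simp_all add: compwise_def F_def)
    show "x = qtn_laurent F"
      using x by (simp add: qtn_eq_iff F_def qtn_laurent_def h(3)[symmetric])
    show "F z = qtn_of (comp0 (F z))" if "x = qtn_of (comp0 x)" for z
    proof -
      have "comp1 x = 0" "comp2 x = 0" "comp3 x = 0"
        using that by (simp_all add: qtn_eq_iff qtn_of_def)
      then show ?thesis
        using h(4)[OF zero_mem] by (simp add: F_def qtn_of_def)
    qed
  qed
qed

end

section \<open>The empty domain\<close>

lemma SEM_select [simp]:
  "mult (SEM \<Omega>) = sem_lift2 \<Omega> star" "smult (SEM \<Omega>) = sem_lift2 \<Omega> star"
  "one (SEM \<Omega>) = sem_class \<Omega> (\<lambda>_. 1)" "zero (SEM \<Omega>) = sem_class \<Omega> (\<lambda>_. 0)"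
  "add (SEM \<Omega>) = sem_lift2 \<Omega> (\<lambda>f g q. f q + g q)"
  by (simp_all add: SEM_def)

lemma SEM_R_select [simp]:
  "mult (SEM_R \<Omega>) = sem_lift2 \<Omega> star" "one (SEM_R \<Omega>) = sem_class \<Omega> (\<lambda>_. 1)"
  by (simp_all add: SEM_R_def)

text \<open>
  Over the empty set there is no base point. There all functions are equivalent, the algebra is
  trivial and every operator on it is bijective, while neither invertible elements nor zero
  divisors exist.
\<close>

lemma sem_class_empty: "sem_class {} f = UNIV"
proof -
  have "sem_domain {} f {}" for f
    by (simp add: sem_domain_def circular_def slice_regular_on_def)
  then show ?thesis
    by (auto simp: sem_class_def sem_rel_def intro!: exI[of _ "{}"])
qed

lemma carrier_SEM_empty: "carrier (SEM {}) = {UNIV}"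
proof -
  have "sem_domain {} f {}" for f
    by (simp add: sem_domain_def circular_def slice_regular_on_def)
  then have "{f. \<exists>D. sem_domain {} f D} = UNIV"
    by blast
  then show ?thesis
    using sem_class_empty by (auto simp: SEM_def quotient_def sem_class_def)
qed

lemma sem_lift2_empty: "sem_lift2 {} h UNIV UNIV = UNIV"
  by (simp add: sem_lift2_def sem_class_empty)

lemma carrier_SEM_R_empty: "carrier (SEM_R {}) = {UNIV}"
proof -
  have "sem_domain {} f {} \<and> slice_preserving_on {} f" for f
    by (simp add: sem_domain_def circular_def slice_regular_on_def slice_preserving_on_def)
  then show ?thesis
    by (auto simp: SEM_R_def carrier_SEM_empty)
qed

lemma sem_conj_empty: "sem_conj {} UNIV = UNIV"
proof -
  have "\<ominus>\<^bsub>SEM {}\<^esub> UNIV = UNIV"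
    unfolding a_inv_def m_inv_def
    by (rule the_equality) (simp_all add: carrier_SEM_empty sem_lift2_empty sem_class_empty)
  then show ?thesis
    unfolding sem_conj_def
    by (simp add: carrier_SEM_R_empty a_minus_def sem_lift2_empty sem_class_empty)
qed

section \<open>The algebra of semi-regular classes\<close>

context circular_domain
begin

lemma carrier_SEM: "carrier (SEM \<Omega>) = semi_regular // sem_rel \<Omega>"
  by (simp add: SEM_def semi_regular_def)

lemma equiv_sem_rel: "equiv semi_regular (sem_rel \<Omega>)"
  by (rule equivI) (auto simp: sem_rel_iff refl_on_def sym_def trans_def)

lemma sem_class_in_carrier: "f \<in> semi_regular \<Longrightarrow> sem_class \<Omega> f \<in> carrier (SEM \<Omega>)"
  by (simp add: carrier_SEM sem_class_def quotientI)

lemma carrier_cases: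
  assumes "A \<in> carrier (SEM \<Omega>)"
  obtains f where "f \<in> semi_regular" "A = sem_class \<Omega> f"
  using assms by (auto simp: carrier_SEM sem_class_def elim: quotientE)

lemma sem_class_eq_iff:
  "f \<in> semi_regular \<Longrightarrow> g \<in> semi_regular \<Longrightarrow>
    sem_class \<Omega> f = sem_class \<Omega> g \<longleftrightarrow> expansion f = expansion g"
  unfolding sem_class_def by (simp add: eq_equiv_class_iff[OF equiv_sem_rel] sem_rel_iff)

lemma mem_sem_class_iff:
  "f \<in> semi_regular \<Longrightarrow> g \<in> sem_class \<Omega> f \<longleftrightarrow> g \<in> semi_regular \<and> expansion g = expansion f"
  by (auto simp: sem_class_def sem_rel_iff)

text \<open>
  The isomorphism from the algebra of classes onto the quaternions over the scalar field; all
  representatives of a class have the same expansion.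
\<close>

definition coords :: "sem \<Rightarrow> complex fls qtn" where
  "coords A = expansion (SOME f. f \<in> A)"

lemma coords_class: "f \<in> semi_regular \<Longrightarrow> coords (sem_class \<Omega> f) = expansion f"
  unfolding coords_def by (rule someI2[of _ f]) (simp_all add: mem_sem_class_iff)

lemma coords_mem: "A \<in> carrier (SEM \<Omega>) \<Longrightarrow> coords A \<in> quaternions"
  by (auto elim!: carrier_cases simp: coords_class expansion_mem)

lemma coords_inject:
  "A \<in> carrier (SEM \<Omega>) \<Longrightarrow> B \<in> carrier (SEM \<Omega>) \<Longrightarrow> coords A = coords B \<longleftrightarrow> A = B"
  using sem_class_eq_iff by (metis carrier_cases coords_class)

lemma coords_surj:
  assumes "x \<in> quaternions"
  obtains A where "A \<in> carrier (SEM \<Omega>)" "coords A = x"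
proof -
  obtain F where F: "compwise symmetric F" "compwise (\<lambda>h. h meromorphic_on U) F" "x = qtn_laurent F"
    using expansion_surj[OF assms] by blast
  show ?thesis
    by (rule that[of "sem_class \<Omega> (unstem F)"])
      (simp_all add: sem_class_in_carrier coords_class unstem_semi_regular[OF F(1,2)] F(3))
qed

lemma bij_coords: "bij_betw coords (carrier (SEM \<Omega>)) quaternions"
  unfolding bij_betw_def inj_on_def
  using coords_inject coords_mem coords_surj by (metis (no_types, lifting) image_iff subsetI subset_antisym)

lemma sem_lift2_class:
  assumes h: "\<And>f g. f \<in> semi_regular \<Longrightarrow> g \<in> semi_regular \<Longrightarrow>
      h f g \<in> semi_regular \<and> expansion (h f g) = H (expansion f) (expansion g)"
    and A: "A \<in> carrier (SEM \<Omega>)" and B: "B \<in> carrier (SEM \<Omega>)"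
  shows "sem_lift2 \<Omega> h A B \<in> carrier (SEM \<Omega>)" "coords (sem_lift2 \<Omega> h A B) = H (coords A) (coords B)"
proof -
  obtain f where f: "f \<in> semi_regular" "A = sem_class \<Omega> f"
    using A by (rule carrier_cases)
  obtain g where g: "g \<in> semi_regular" "B = sem_class \<Omega> g"
    using B by (rule carrier_cases)
  have "sem_class \<Omega> (h f' g') = sem_class \<Omega> (h f g)" if "f' \<in> A" "g' \<in> B" for f' g'
    using that h[of f' g'] h[OF f(1) g(1)] by (simp add: f g mem_sem_class_iff sem_class_eq_iff)
  moreover have "f \<in> A" "g \<in> B"
    using f g by (simp_all add: mem_sem_class_iff)
  ultimately have "sem_lift2 \<Omega> h A B = sem_class \<Omega> (h f g)"
    unfolding sem_lift2_def by blast
  then show "sem_lift2 \<Omega> h A B \<in> carrier (SEM \<Omega>)" "coords (sem_lift2 \<Omega> h A B) = H (coords A) (coords B)"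
    using f g h[OF f(1) g(1)] by (simp_all add: sem_class_in_carrier coords_class)
qed

lemma coords_star:
  assumes "A \<in> carrier (SEM \<Omega>)" "B \<in> carrier (SEM \<Omega>)"
  shows "sem_lift2 \<Omega> star A B \<in> carrier (SEM \<Omega>)"
    "coords (sem_lift2 \<Omega> star A B) = coords A * coords B"
  using sem_lift2_class[of star "(*)", OF _ assms] semi_regular_operations(3,4) by blast+

lemma coords_add:
  assumes "A \<in> carrier (SEM \<Omega>)" "B \<in> carrier (SEM \<Omega>)"
  shows "sem_lift2 \<Omega> (\<lambda>f g q. f q + g q) A B \<in> carrier (SEM \<Omega>)"
    "coords (sem_lift2 \<Omega> (\<lambda>f g q. f q + g q) A B) = coords A + coords B"
  using sem_lift2_class[of "\<lambda>f g q. f q + g q" "(+)", OF _ assms] semi_regular_operations(1,2)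
  by blast+

lemma coords_const:
  "sem_class \<Omega> (\<lambda>_. q) \<in> carrier (SEM \<Omega>)"
  "coords (sem_class \<Omega> (\<lambda>_. q)) = Qtn (fls_const (of_real (Req q))) (fls_const (of_real (Im1 q)))
       (fls_const (of_real (Im2 q))) (fls_const (of_real (Im3 q)))" for q :: quat
  by (simp_all add: sem_class_in_carrier coords_class const_semi_regular)

lemma coords_0: "coords (sem_class \<Omega> (\<lambda>_. 0)) = 0"
  by (simp add: coords_const zero_quat_def zero_qtn_def)

lemma coords_1: "coords (sem_class \<Omega> (\<lambda>_. 1)) = 1"
  by (simp add: coords_const one_quat_def one_qtn_def)

lemma coords_eq_0_iff:
  "A \<in> carrier (SEM \<Omega>) \<Longrightarrow> A = \<zero>\<^bsub>SEM \<Omega>\<^esub> \<longleftrightarrow> coords A = 0"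
  using coords_inject[of A "sem_class \<Omega> (\<lambda>_. 0)"] by (simp add: coords_const(1) coords_0)

lemma coords_uminus:
  assumes A: "A \<in> carrier (SEM \<Omega>)"
  shows "\<ominus>\<^bsub>SEM \<Omega>\<^esub> A \<in> carrier (SEM \<Omega>)" "coords (\<ominus>\<^bsub>SEM \<Omega>\<^esub> A) = - coords A"
proof -
  have "- coords A \<in> quaternions"
    using A by (simp add: coords_mem quaternions_closed)
  then obtain B where B: "B \<in> carrier (SEM \<Omega>)" "coords B = - coords A"
    by (rule coords_surj)
  have "\<ominus>\<^bsub>SEM \<Omega>\<^esub> A = B"
    unfolding a_inv_def m_inv_def
  proof (rule the_equality)
    show "B \<in> carrier (add_monoid (SEM \<Omega>)) \<and>
        A \<otimes>\<^bsub>add_monoid (SEM \<Omega>)\<^esub> B = \<one>\<^bsub>add_monoid (SEM \<Omega>)\<^esub> \<and>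
        B \<otimes>\<^bsub>add_monoid (SEM \<Omega>)\<^esub> A = \<one>\<^bsub>add_monoid (SEM \<Omega>)\<^esub>"
      using A B by (simp add: coords_add coords_const(1) coords_0 flip: coords_inject)
  next
    fix C assume C: "C \<in> carrier (add_monoid (SEM \<Omega>)) \<and>
        A \<otimes>\<^bsub>add_monoid (SEM \<Omega>)\<^esub> C = \<one>\<^bsub>add_monoid (SEM \<Omega>)\<^esub> \<and>
        C \<otimes>\<^bsub>add_monoid (SEM \<Omega>)\<^esub> A = \<one>\<^bsub>add_monoid (SEM \<Omega>)\<^esub>"
    then have "coords A + coords C = 0"
      using A coords_add(2)[of A C] by (simp add: coords_0)
    then have "coords C = coords B"
      unfolding B(2) by (metis add.commute eq_neg_iff_add_eq_0)
    then show "C = B"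
      using B C coords_inject[of C B] by simp
  qed
  with B show "\<ominus>\<^bsub>SEM \<Omega>\<^esub> A \<in> carrier (SEM \<Omega>)" "coords (\<ominus>\<^bsub>SEM \<Omega>\<^esub> A) = - coords A"
    by simp_all
qed

text \<open>
  Evaluating at \<open>J\<close> and \<open>- J\<close> shows that \<open>F\<^sub>1\<close> and \<open>F\<^sub>2\<close> lie in \<open>\<complex>\<^sub>J\<close> for every \<open>J\<close>, and
  \<open>\<complex>\<^sub>i \<inter> \<complex>\<^sub>j = \<real>\<close>.
\<close>

lemma slice_preserving_imp_scalar:
  assumes D: "sem_domain \<Omega> f D" and f: "slice_preserving_on D f"
  shows "expansion f = qtn_of (comp0 (expansion f))"
proof -
  have D': "ample D" "circular D" "sliced_on D f"
    using D by (auto simp: sem_domain_iff ample_def)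
  have stem: "stem f z = qtn_of (comp0 (stem f z))" if z: "z \<in> shadow D" for z
  proof -
    have in_plane: "slice_eval J (stem f z) \<in> slice_plane J" if J: "J \<in> imag_units" for J
    proof -
      have "emb J z \<in> D \<inter> slice_plane J"
        using z unfolding Int_iff emb_in_circular_iff[OF D'(2) J]
        by (auto simp: slice_plane_def emb_def)
      moreover have "f (emb J z) = slice_eval J (stem f z)"
        using D'(3) J z by (simp add: sliced_on_def)
      ultimately show ?thesis
        using f J unfolding slice_preserving_on_def by (metis image_subset_iff)
    qed
    have j: "quat_j \<in> imag_units"
      by (simp add: imag_units_iff quat_j_def)
    have plane_i: "Im2 q = 0 \<and> Im3 q = 0" if "q \<in> slice_plane quat_i \<or> q \<in> slice_plane (- quat_i)" for q
      using that by (auto simp: slice_plane_def quat_simps)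
    have plane_j: "Im1 q = 0 \<and> Im3 q = 0" if "q \<in> slice_plane quat_j \<or> q \<in> slice_plane (- quat_j)" for q
      using that by (auto simp: slice_plane_def quat_simps quat_j_def)
    have "Im2 (slice_eval J (stem f z)) = 0 \<and> Im3 (slice_eval J (stem f z)) = 0"
      if "J = quat_i \<or> J = - quat_i" for J
      using plane_i in_plane that quat_i_imag_unit uminus_imag_unit by metis
    from this[of quat_i] this[of "- quat_i"]
    have "Re (comp2 (stem f z)) = 0" "Im (comp2 (stem f z)) = 0" "Re (comp3 (stem f z)) = 0"
      "Im (comp3 (stem f z)) = 0"
      by (auto simp: stem_simps quat_simps)
    moreover have "Im1 (slice_eval J (stem f z)) = 0 \<and> Im3 (slice_eval J (stem f z)) = 0"
      if "J = quat_j \<or> J = - quat_j" for J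
      using plane_j in_plane that j uminus_imag_unit by metis
    from this[of quat_j] this[of "- quat_j"] calculation
    have "Re (comp1 (stem f z)) = 0" "Im (comp1 (stem f z)) = 0"
      by (auto simp: stem_simps quat_simps quat_j_def)
    ultimately show ?thesis
      by (simp add: qtn_eq_iff qtn_of_def complex_eq_iff)
  qed
  have "eventually (\<lambda>w. w \<in> shadow D) (at z0)"
    using D'(1) base_point by (simp add: ample_def)
  then have "eventually (\<lambda>w. stem f w = qtn_of (comp0 (stem f w))) (at z0)"
    by eventually_elim (rule stem)
  then have "expansion f = qtn_laurent (\<lambda>w. qtn_of (comp0 (stem f w)))"
    unfolding expansion_def by (rule qtn_laurent_cong)
  also have "laurent_expansion (\<lambda>_. 0) z0 = 0"
    by (intro laurent_expansion_eqI) simp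
  then have "qtn_laurent (\<lambda>w. qtn_of (comp0 (stem f w))) = qtn_of (laurent_expansion (\<lambda>w. comp0 (stem f w)) z0)"
    by (simp add: qtn_laurent_def qtn_of_def)
  finally show ?thesis
    by (simp add: qtn_of_def)
qed

lemma carrier_SEM_R:
  "carrier (SEM_R \<Omega>) = {A \<in> carrier (SEM \<Omega>). \<exists>a. coords A = qtn_of a}"
proof (intro equalityI subsetI)
  fix A assume "A \<in> carrier (SEM_R \<Omega>)"
  then obtain f D where A: "A \<in> carrier (SEM \<Omega>)" and f: "f \<in> A" "sem_domain \<Omega> f D" "slice_preserving_on D f"
    by (auto simp: SEM_R_def)
  have "A = sem_class \<Omega> f"
    using A f(1) by (elim carrier_cases) (auto simp: mem_sem_class_iff sem_class_eq_iff)
  moreover have "f \<in> semi_regular"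
    using f(2) by (auto simp: semi_regular_def)
  ultimately have "coords A = expansion f"
    by (simp add: coords_class)
  with slice_preserving_imp_scalar[OF f(2,3)] A
  show "A \<in> {A \<in> carrier (SEM \<Omega>). \<exists>a. coords A = qtn_of a}"
    by auto
next
  fix A assume "A \<in> {A \<in> carrier (SEM \<Omega>). \<exists>a. coords A = qtn_of a}"
  then have A: "A \<in> carrier (SEM \<Omega>)" and scalar: "coords A = qtn_of (comp0 (coords A))"
    by (auto simp: qtn_of_def)
  obtain F where F: "compwise symmetric F" "compwise (\<lambda>h. h meromorphic_on U) F"
    "coords A = qtn_laurent F" "\<And>z. F z = qtn_of (comp0 (F z))"
    using expansion_surj[OF coords_mem[OF A]] scalar by metis
  let ?f = "unstem F"
  obtain D where D: "sem_domain \<Omega> ?f D"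
    using unstem_semi_regular(1)[OF F(1,2)] by (auto simp: semi_regular_def)
  have "?f \<in> A"
    using A unstem_semi_regular[OF F(1,2)] F(3)
    by (elim carrier_cases) (simp add: mem_sem_class_iff coords_class)
  moreover have "slice_preserving_on D ?f"
    unfolding slice_preserving_on_def
  proof (intro ballI image_subsetI)
    fix I q assume I: "I \<in> imag_units" and "q \<in> D \<inter> slice_plane I"
    then obtain x y where "q = of_real x + I * of_real y"
      by (auto simp: slice_plane_def)
    then obtain z where "q = emb I z"
      using that[of "Complex x y"] by (simp add: emb_def)
    then have "?f q = slice_eval I (qtn_of (comp0 (F z)))"
      using unstem_emb[OF F(1) I] F(4) by metis
    also have "\<dots> = of_real (Re (comp0 (F z))) + I * of_real (Im (comp0 (F z)))"
      by (simp add: stem_simps qtn_of_def quat_simps)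
    finally show "?f q \<in> slice_plane I"
      by (auto simp: slice_plane_def)
  qed
  ultimately show "A \<in> carrier (SEM_R \<Omega>)"
    using A D by (auto simp: SEM_R_def)
qed

text \<open>
  Only the slice preserving classes compete for the inverse here; the class whose coordinate is the
  inverse scalar is one of them, and inverses are unique.
\<close>

lemma coords_SEM_R_inverse:
  assumes A: "A \<in> carrier (SEM \<Omega>)" "coords A = qtn_of a" "a \<noteq> 0"
  shows "inv\<^bsub>SEM_R \<Omega>\<^esub> A \<in> carrier (SEM \<Omega>)" "coords (inv\<^bsub>SEM_R \<Omega>\<^esub> A) = qtn_of (inverse a)"
proof -
  have "a \<in> scalar_field"
    using coords_mem[OF A(1)] A(2) by (simp add: qtn_of_def Qtn_mem_iff)
  then have "qtn_of (inverse a) \<in> quaternions"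
    by (simp add: quaternions_closed K_closed)
  then obtain B where B: "B \<in> carrier (SEM \<Omega>)" "coords B = qtn_of (inverse a)"
    by (rule coords_surj)
  have unit: "qtn_of (inverse a) * qtn_of a = 1" "qtn_of a * qtn_of (inverse a) = 1"
    using A(3) by (simp_all add: qtn_of_1 flip: qtn_of_mult)
  have "inv\<^bsub>SEM_R \<Omega>\<^esub> A = B"
    unfolding m_inv_def
  proof (rule the_equality)
    show "B \<in> carrier (SEM_R \<Omega>) \<and> A \<otimes>\<^bsub>SEM_R \<Omega>\<^esub> B = \<one>\<^bsub>SEM_R \<Omega>\<^esub> \<and> B \<otimes>\<^bsub>SEM_R \<Omega>\<^esub> A = \<one>\<^bsub>SEM_R \<Omega>\<^esub>"
      using A B unit by (auto simp: carrier_SEM_R coords_star coords_const(1) coords_1 simp flip: coords_inject)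
  next
    fix C assume C: "C \<in> carrier (SEM_R \<Omega>) \<and> A \<otimes>\<^bsub>SEM_R \<Omega>\<^esub> C = \<one>\<^bsub>SEM_R \<Omega>\<^esub> \<and> C \<otimes>\<^bsub>SEM_R \<Omega>\<^esub> A = \<one>\<^bsub>SEM_R \<Omega>\<^esub>"
    then have "C \<in> carrier (SEM \<Omega>)"
      by (simp add: carrier_SEM_R)
    have "qtn_of a * coords C = 1"
      using C A coords_star(2)[OF A(1) \<open>C \<in> carrier (SEM \<Omega>)\<close>] by (simp add: coords_1)
    then have "coords C = qtn_of (inverse a) * 1"
      using unit by (metis mult.assoc mult_1_left)
    then show "C = B"
      using B \<open>C \<in> carrier (SEM \<Omega>)\<close> by (simp flip: coords_inject)
  qed
  with B show "inv\<^bsub>SEM_R \<Omega>\<^esub> A \<in> carrier (SEM \<Omega>)" "coords (inv\<^bsub>SEM_R \<Omega>\<^esub> A) = qtn_of (inverse a)"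
    by simp_all
qed

text \<open>
  Any decomposition \<open>f\<^sub>0 + f\<^sub>1 i + f\<^sub>2 j + f\<^sub>3 k\<close> with scalar \<open>f\<^sub>l\<close> exhibits the four coordinates of the
  class, so the defining description of the conjugate has exactly one solution.
\<close>

lemma coords_conj:
  assumes A: "A \<in> carrier (SEM \<Omega>)"
  shows "sem_conj \<Omega> A \<in> carrier (SEM \<Omega>)" "coords (sem_conj \<Omega> A) = qtn_conj (coords A)"
proof -
  let ?R = "carrier (SEM_R \<Omega>)"
  let ?v = "\<lambda>f1 f2 f3. f1 \<otimes>\<^bsub>SEM \<Omega>\<^esub> sem_class \<Omega> (\<lambda>_. quat_i)
                \<oplus>\<^bsub>SEM \<Omega>\<^esub> f2 \<otimes>\<^bsub>SEM \<Omega>\<^esub> sem_class \<Omega> (\<lambda>_. quat_j)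
                \<oplus>\<^bsub>SEM \<Omega>\<^esub> f3 \<otimes>\<^bsub>SEM \<Omega>\<^esub> sem_class \<Omega> (\<lambda>_. quat_k)"
  have v: "?v f1 f2 f3 \<in> carrier (SEM \<Omega>)"
      "coords (?v f1 f2 f3) = Qtn 0 (comp0 (coords f1)) (comp0 (coords f2)) (comp0 (coords f3))"
    if "f1 \<in> ?R" "f2 \<in> ?R" "f3 \<in> ?R" for f1 f2 f3
    using that
    by (auto simp: carrier_SEM_R coords_add coords_star coords_const quat_i_def quat_j_def quat_k_def
        qtn_ring_defs qtn_of_def)
  have minus: "B \<ominus>\<^bsub>SEM \<Omega>\<^esub> C \<in> carrier (SEM \<Omega>)" "coords (B \<ominus>\<^bsub>SEM \<Omega>\<^esub> C) = coords B - coords C"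
    if "B \<in> carrier (SEM \<Omega>)" "C \<in> carrier (SEM \<Omega>)" for B C
    using that coords_uminus[of C] by (simp_all add: a_minus_def coords_add)
  define P where "P c \<longleftrightarrow> (\<exists>f0\<in>?R. \<exists>f1\<in>?R. \<exists>f2\<in>?R. \<exists>f3\<in>?R.
      A = f0 \<oplus>\<^bsub>SEM \<Omega>\<^esub> ?v f1 f2 f3 \<and> c = f0 \<ominus>\<^bsub>SEM \<Omega>\<^esub> ?v f1 f2 f3)" for c
  have P: "c \<in> carrier (SEM \<Omega>) \<and> coords c = qtn_conj (coords A)" if Pc: "P c" for c
  proof -
    obtain f0 f1 f2 f3 where f: "f0 \<in> ?R" "f1 \<in> ?R" "f2 \<in> ?R" "f3 \<in> ?R"
      "A = f0 \<oplus>\<^bsub>SEM \<Omega>\<^esub> ?v f1 f2 f3" "c = f0 \<ominus>\<^bsub>SEM \<Omega>\<^esub> ?v f1 f2 f3"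
      using Pc unfolding P_def by blast
    have f0: "f0 \<in> carrier (SEM \<Omega>)" "coords f0 = qtn_of (comp0 (coords f0))"
      using f(1) by (auto simp: carrier_SEM_R qtn_of_def)
    have "coords A = coords f0 + coords (?v f1 f2 f3)"
      unfolding f(5) using coords_add(2)[OF f0(1) v(1)[OF f(2-4)]] by simp
    moreover have "coords c = coords f0 - coords (?v f1 f2 f3)" "c \<in> carrier (SEM \<Omega>)"
      unfolding f(6) using minus[OF f0(1) v(1)[OF f(2-4)]] by simp_all
    moreover have "qtn_of x - Qtn 0 y1 y2 y3 = qtn_conj (qtn_of x + Qtn 0 y1 y2 y3)"
      for x y1 y2 y3 :: "complex fls"
      by (simp add: qtn_simps)
    ultimately show ?thesis
      using v(2)[OF f(2-4)] f0(2) by metis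
  qed
  have scalar: "\<exists>f\<in>?R. coords f = qtn_of a" if "a \<in> scalar_field" for a
  proof -
    have "qtn_of a \<in> quaternions"
      using that by (rule quaternions_closed(7))
    then obtain B where "B \<in> carrier (SEM \<Omega>)" "coords B = qtn_of a"
      by (rule coords_surj)
    then show ?thesis
      by (auto simp: carrier_SEM_R)
  qed
  have mem: "comp0 (coords A) \<in> scalar_field" "comp1 (coords A) \<in> scalar_field"
    "comp2 (coords A) \<in> scalar_field" "comp3 (coords A) \<in> scalar_field"
    using coords_mem[OF A] by (simp_all add: mem_quaternions_iff)
  obtain f0 where f0: "f0 \<in> ?R" "coords f0 = qtn_of (comp0 (coords A))"
    using scalar[OF mem(1)] by blast
  obtain f1 where f1: "f1 \<in> ?R" "coords f1 = qtn_of (comp1 (coords A))"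
    using scalar[OF mem(2)] by blast
  obtain f2 where f2: "f2 \<in> ?R" "coords f2 = qtn_of (comp2 (coords A))"
    using scalar[OF mem(3)] by blast
  obtain f3 where f3: "f3 \<in> ?R" "coords f3 = qtn_of (comp3 (coords A))"
    using scalar[OF mem(4)] by blast
  note v' = v[OF f1(1) f2(1) f3(1)]
  have f0': "f0 \<in> carrier (SEM \<Omega>)"
    using f0(1) by (simp add: carrier_SEM_R)
  have "coords (f0 \<oplus>\<^bsub>SEM \<Omega>\<^esub> ?v f1 f2 f3) = coords f0 + coords (?v f1 f2 f3)"
    using coords_add(2)[OF f0' v'(1)] by simp
  also have "\<dots> = coords A"
    unfolding v'(2) f0 f1 f2 f3 by (simp add: qtn_simps)
  finally have "A = f0 \<oplus>\<^bsub>SEM \<Omega>\<^esub> ?v f1 f2 f3"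
    using coords_inject[OF A, THEN iffD1, of "f0 \<oplus>\<^bsub>SEM \<Omega>\<^esub> ?v f1 f2 f3"]
      coords_add(1)[OF f0' v'(1)] by simp
  then have P_witness: "P (f0 \<ominus>\<^bsub>SEM \<Omega>\<^esub> ?v f1 f2 f3)"
    unfolding P_def using f0(1) f1(1) f2(1) f3(1) by blast
  have "P (THE c. P c)"
  proof (rule theI[of P, OF P_witness])
    fix c assume "P c"
    from P[OF this] P[OF P_witness] show "c = f0 \<ominus>\<^bsub>SEM \<Omega>\<^esub> ?v f1 f2 f3"
      by (intro coords_inject[THEN iffD1]) simp_all
  qed
  then have "P (sem_conj \<Omega> A)"
    by (simp only: sem_conj_def Let_def P_def[abs_def])
  then show "sem_conj \<Omega> A \<in> carrier (SEM \<Omega>)" "coords (sem_conj \<Omega> A) = qtn_conj (coords A)"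
    using P by blast+
qed

lemma coords_symm:
  assumes "A \<in> carrier (SEM \<Omega>)"
  shows "sem_symm \<Omega> A \<in> carrier (SEM \<Omega>)" "coords (sem_symm \<Omega> A) = qtn_of (qtn_norm (coords A))"
  using assms coords_conj[OF assms] by (simp_all add: sem_symm_def coords_star qtn_mult_conj)

lemma star_invertible_iff:
  "star_invertible \<Omega> A \<longleftrightarrow> A \<in> carrier (SEM \<Omega>) \<and> qtn_norm (coords A) \<noteq> 0"
  unfolding star_invertible_def
  using coords_eq_0_iff[OF coords_symm(1)] coords_symm(2) qtn_of_eq_0_iff by metis

lemma sem_zero_divisor_iff:
  "sem_zero_divisor \<Omega> A \<longleftrightarrow> A \<in> carrier (SEM \<Omega>) \<and> coords A \<noteq> 0 \<and> qtn_norm (coords A) = 0"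
  unfolding sem_zero_divisor_def
  using coords_eq_0_iff coords_eq_0_iff[OF coords_symm(1)] coords_symm(2) qtn_of_eq_0_iff by metis

lemma coords_star_inverse:
  assumes "A \<in> carrier (SEM \<Omega>)" "qtn_norm (coords A) \<noteq> 0"
  shows "star_inverse \<Omega> A \<in> carrier (SEM \<Omega>)"
    "coords (star_inverse \<Omega> A) = qtn_of (inverse (qtn_norm (coords A))) * qtn_conj (coords A)"
  using coords_SEM_R_inverse[OF coords_symm[OF assms(1)] assms(2)] coords_conj[OF assms(1)]
  by (simp_all add: star_inverse_def coords_star)

end

section \<open>The Sylvester operator\<close>

context circular_domain
begin

lemma star_conjugate_iff:
  assumes A: "A \<in> carrier (SEM \<Omega>)" and B: "B \<in> carrier (SEM \<Omega>)"
  shows "star_conjugate \<Omega> A B \<longleftrightarrow>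
    (\<exists>u\<in>quaternions. qtn_norm u \<noteq> 0 \<and> coords A * u = u * coords B)"
proof -
  have "star_conjugate \<Omega> A B \<longleftrightarrow> (\<exists>C\<in>carrier (SEM \<Omega>). qtn_norm (coords C) \<noteq> 0 \<and>
      coords A = qtn_of (inverse (qtn_norm (coords C))) * qtn_conj (coords C) * coords B * coords C)"
  proof -
    have "A = star_inverse \<Omega> C \<otimes>\<^bsub>SEM \<Omega>\<^esub> B \<otimes>\<^bsub>SEM \<Omega>\<^esub> C \<longleftrightarrow>
      coords A = qtn_of (inverse (qtn_norm (coords C))) * qtn_conj (coords C) * coords B * coords C"
      if C: "C \<in> carrier (SEM \<Omega>)" "qtn_norm (coords C) \<noteq> 0" for C
      using A B C coords_star_inverse[OF C] by (simp add: coords_star flip: coords_inject)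
    then show ?thesis
      unfolding star_conjugate_def star_invertible_iff by blast
  qed
  also have "\<dots> \<longleftrightarrow> (\<exists>h\<in>quaternions. qtn_norm h \<noteq> 0 \<and>
      coords A = qtn_of (inverse (qtn_norm h)) * qtn_conj h * coords B * h)"
    unfolding bij_betw_imp_surj_on[OF bij_coords, symmetric] by blast
  finally show ?thesis
    unfolding conjugate_iff_invertible_intertwiner .
qed

lemma intertwining_zero_divisor_iff:
  assumes A: "A \<in> carrier (SEM \<Omega>)" and B: "B \<in> carrier (SEM \<Omega>)"
  shows "(\<exists>X. sem_zero_divisor \<Omega> X \<and> intertwines \<Omega> A B X) \<longleftrightarrow>
    (\<exists>u\<in>quaternions. u \<noteq> 0 \<and> qtn_norm u = 0 \<and> coords A * u = u * coords B)"
proof -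
  have "intertwines \<Omega> A B X \<longleftrightarrow> coords A * coords X = coords X * coords B" if "X \<in> carrier (SEM \<Omega>)" for X
    using A B that by (simp add: intertwines_def coords_star flip: coords_inject)
  then show ?thesis
    unfolding sem_zero_divisor_iff bij_betw_imp_surj_on[OF bij_coords, symmetric] by blast
qed

text \<open>
  Linearity over the scalars is automatic because scalars are central, so only bijectivity is at
  stake, and it is transported along the coordinate isomorphism.
\<close>

lemma sylvester_iso_iff:
  assumes A: "A \<in> carrier (SEM \<Omega>)" and B: "B \<in> carrier (SEM \<Omega>)"
  shows "sylvester \<Omega> A B \<in> module_iso (SEM_R \<Omega>) (SEM \<Omega>) (SEM \<Omega>) \<longleftrightarrow>
    bij_betw (\<lambda>x. coords A * x + x * coords B) quaternions quaternions"
proof -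
  let ?C = "carrier (SEM \<Omega>)" and ?T = "sylvester \<Omega> A B"
  let ?S = "\<lambda>x. coords A * x + x * coords B"
  have T: "?T X \<in> ?C" "coords (?T X) = ?S (coords X)" if "X \<in> ?C" for X
    using A B that by (simp_all add: sylvester_def coords_star coords_add)
  have "?T (X \<oplus>\<^bsub>SEM \<Omega>\<^esub> Y) = ?T X \<oplus>\<^bsub>SEM \<Omega>\<^esub> ?T Y" if "X \<in> ?C" "Y \<in> ?C" for X Y
    using that by (simp add: coords_add T algebra_simps flip: coords_inject)
  moreover have "?T (a \<odot>\<^bsub>SEM \<Omega>\<^esub> X) = a \<odot>\<^bsub>SEM \<Omega>\<^esub> ?T X" if a: "a \<in> carrier (SEM_R \<Omega>)" and X: "X \<in> ?C" for a X
  proof -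
    obtain r where r: "coords a = qtn_of r" and a': "a \<in> ?C"
      using a by (auto simp: carrier_SEM_R)
    have "?S (coords a * coords X) = coords a * ?S (coords X)"
      unfolding r by (simp add: distrib_left mult.assoc[symmetric] qtn_of_central[of r "coords A"])
    then show ?thesis
      using a' X by (simp add: coords_star T flip: coords_inject)
  qed
  ultimately have "?T \<in> module_iso (SEM_R \<Omega>) (SEM \<Omega>) (SEM \<Omega>) \<longleftrightarrow> bij_betw ?T ?C ?C"
    by (simp add: module_iso_def)
  also have "\<dots> \<longleftrightarrow> bij_betw (coords \<circ> ?T) ?C quaternions"
    using T by (intro bij_betw_comp_iff2[OF bij_coords]) auto
  also have "\<dots> \<longleftrightarrow> bij_betw (?S \<circ> coords) ?C quaternions"
    using T by (intro bij_betw_cong) simp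
  also have "\<dots> \<longleftrightarrow> bij_betw ?S quaternions quaternions"
    by (rule bij_betw_comp_iff[OF bij_coords, symmetric])
  finally show ?thesis .
qed

end

theorem proposition4p13:
  fixes \<Omega> :: "quat set" and f g :: sem
  assumes "open \<Omega>" and "connected \<Omega>" and "circular \<Omega>"
    and "f \<in> carrier (SEM \<Omega>)" and "g \<in> carrier (SEM \<Omega>)"
  shows "sylvester \<Omega> f g \<notin> module_iso (SEM_R \<Omega>) (SEM \<Omega>) (SEM \<Omega>) \<longleftrightarrow>
    star_conjugate \<Omega> f (\<ominus>\<^bsub>SEM \<Omega>\<^esub> g) \<or>
    (\<exists>X. sem_zero_divisor \<Omega> X \<and> intertwines \<Omega> f (\<ominus>\<^bsub>SEM \<Omega>\<^esub> g) X)"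
proof (cases "\<Omega> = {}")
  case True
  have "sylvester {} UNIV UNIV \<in> module_iso (SEM_R {}) (SEM {}) (SEM {})"
    by (simp add: module_iso_def carrier_SEM_empty carrier_SEM_R_empty sylvester_def sem_lift2_empty
        bij_betw_def)
  moreover have "\<not> star_invertible {} h" for h
    by (auto simp: star_invertible_def sem_symm_def carrier_SEM_empty sem_conj_empty sem_lift2_empty
        sem_class_empty)
  moreover have "\<not> sem_zero_divisor {} X" for X
    by (auto simp: sem_zero_divisor_def carrier_SEM_empty sem_class_empty)
  moreover have "f = UNIV" "g = UNIV"
    using assms(4,5) True by (simp_all add: carrier_SEM_empty)
  ultimately show ?thesis
    using True by (simp add: star_conjugate_def)
next
  case False
  then obtain q where "q \<in> \<Omega>"
    by blast
  then interpret circular_domain \<Omega> "sphere_label q"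
    using assms by unfold_locales (simp_all add: sphere_label_in_shadow_iff)
  have "sylvester \<Omega> f g \<notin> module_iso (SEM_R \<Omega>) (SEM \<Omega>) (SEM \<Omega>) \<longleftrightarrow>
      (\<exists>u\<in>quaternions. u \<noteq> 0 \<and> coords f * u = u * - coords g)"
    using sylvester_bij_iff[OF coords_mem[OF assms(4)] coords_mem[OF assms(5)]]
      sylvester_iso_iff[OF assms(4,5)] by blast
  also have "\<dots> \<longleftrightarrow> (\<exists>u\<in>quaternions. qtn_norm u \<noteq> 0 \<and> coords f * u = u * - coords g) \<or>
      (\<exists>u\<in>quaternions. u \<noteq> 0 \<and> qtn_norm u = 0 \<and> coords f * u = u * - coords g)"
  proof -
    have "u \<noteq> 0" if "qtn_norm u \<noteq> 0" for u :: "complex fls qtn"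
      using that by (auto simp: qtn_norm_def zero_qtn_def)
    then show ?thesis
      by metis
  qed
  finally show ?thesis
    using star_conjugate_iff[OF assms(4) coords_uminus(1)[OF assms(5)]]
      intertwining_zero_divisor_iff[OF assms(4) coords_uminus(1)[OF assms(5)]]
    by (simp add: coords_uminus(2)[OF assms(5)])
qed

end
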